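(* Let $u\in C^\infty(\mathbb R^3;\mathbb R^3)$ and $p\in C^\infty(\mathbb R^3)$ satisfy the stationary Navier–Stokes system $$u\cdot\nabla u-\Delta u=\nabla p,\qquad \operatorname{div}u=0\quad\text{in }\mathbb R^3.$$ Assume that $u\in BMO^{-1}(\mathbb R^3)$ and that $\int_{\mathbb R^3}|\nabla u|^2\,dx<\infty$. Then $u\equiv 0$ in $\mathbb R^3$.
   Context: A divergence-free vector field $u$ on $\mathbb R^3$ is said to belong to $BMO^{-1}(\mathbb R^3)$ if there exists a skew-symmetric matrix-valued function $d=(d_{ij})_{i,j=1}^3$ (i.e. $d_{ij}=-d_{ji}$) with all entries in $BMO(\mathbb R^3)$ such that $u=\operatorname{div} d$, i.e. $u_i=\sum_{j}\partial_j d_{ij}$ (in the sense of distributions). Here $(u\cdot\nabla u)_i=\sum_j u_j\partial_j u_i$. *)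

theory Defs
  imports "HOL-Analysis.Analysis"
begin

definition partial :: "3 \<Rightarrow> (real^3 \<Rightarrow> real) \<Rightarrow> real^3 \<Rightarrow> real" where
  "partial j g = (\<lambda>x. deriv (\<lambda>t. g (x + t *\<^sub>R axis j 1)) 0)"

fun pderivs :: "3 list \<Rightarrow> (real^3 \<Rightarrow> real) \<Rightarrow> real^3 \<Rightarrow> real" where
  "pderivs [] g = g"
| "pderivs (j # js) g = partial j (pderivs js g)"

definition smooth_fun :: "(real^3 \<Rightarrow> real) \<Rightarrow> bool" where
  "smooth_fun g \<longleftrightarrow>
     (\<forall>js. continuous_on UNIV (pderivs js g) \<and>
           (\<forall>j x. (\<lambda>t. pderivs js g (x + t *\<^sub>R axis j 1)) differentiable (at 0)))"

definition test_fun :: "(real^3 \<Rightarrow> real) \<Rightarrow> bool" where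
  "test_fun \<phi> \<longleftrightarrow> smooth_fun \<phi> \<and> compact (closure {x. \<phi> x \<noteq> 0})"

definition avg :: "(real^3 \<Rightarrow> real) \<Rightarrow> (real^3) set \<Rightarrow> real" where
  "avg f B = (LINT y:B|lborel. f y) / measure lborel B"

definition BMO :: "(real^3 \<Rightarrow> real) \<Rightarrow> bool" where
  "BMO f \<longleftrightarrow>
     (\<forall>x r. r > 0 \<longrightarrow> set_integrable lborel (ball x r) f) \<and>
     (\<exists>C. \<forall>x r. r > 0 \<longrightarrow> avg (\<lambda>y. \<bar>f y - avg f (ball x r)\<bar>) (ball x r) \<le> C)"

definition BMO_minus1 :: "(real^3 \<Rightarrow> real^3) \<Rightarrow> bool" where
  "BMO_minus1 u \<longleftrightarrow>
     (\<exists>d :: 3 \<Rightarrow> 3 \<Rightarrow> real^3 \<Rightarrow> real.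
        (\<forall>i j x. d i j x = - d j i x) \<and>
        (\<forall>i j. BMO (d i j)) \<and>
        (\<forall>i \<phi>. test_fun \<phi> \<longrightarrow>
           (\<integral>x. u x $ i * \<phi> x \<partial>lborel) =
             - (\<Sum>j\<in>UNIV. \<integral>x. d i j x * partial j \<phi> x \<partial>lborel)))"

end

theory Submission
  imports Defs
begin

text \<open>
  Mollifying \<open>u\<close> at scale \<open>\<rho>\<close> and moving the derivative onto the mollifier bounds the mollified field by
  \<open>K / \<rho>\<close>, using only mean oscillations of \<open>d\<close> on balls.  On the other hand \<open>u\<close> differs from its
  mollification by at most \<open>\<rho>\<close> times an average of \<open>\<bar>\<nabla>u\<bar>\<close>.  Taking \<open>\<rho>\<close> proportional to \<open>1 / \<lambda>\<close> on the set
  \<open>\<bar>u\<bar> \<ge> \<lambda>\<close> and integrating over the levels \<open>\<lambda>\<close> gives \<open>u \<in> L\<^sup>4\<close> from \<open>\<nabla>u \<in> L\<^sup>2\<close>.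

  Write \<open>u\<^sub>i = \<Sum>j. \<partial>\<^sub>j D\<^sub>i\<^sub>j\<close> with the explicit skew potential
  \<open>D\<^sub>i\<^sub>j(x) = \<integral>\<^sub>0\<^sup>1 t (x\<^sub>j u\<^sub>i(tx) - x\<^sub>i u\<^sub>j(tx)) dt\<close> and test the equation with \<open>\<Sum>j. \<partial>\<^sub>j (\<phi>\<^sub>R D\<^sub>i\<^sub>j)\<close>, where \<open>\<phi>\<^sub>R\<close> cuts off
  between the radii \<open>R\<close> and \<open>2R\<close>.  This field is divergence free, so no pressure term remains, and
  \<open>\<integral> \<phi>\<^sub>R \<bar>\<nabla>u\<bar>\<^sup>2\<close> equals a sum of error terms supported in the shell \<open>R \<le> \<bar>x\<bar> \<le> 2R\<close>.  By Young's inequality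
  they are at most a constant times
  \<open>\<bar>u\<bar>\<^sup>4 + \<bar>\<nabla>u\<bar>\<^sup>2 + (\<integral>\<^sub>0\<^sup>1 t \<bar>u(tx)\<bar> dt)\<^sup>4 + (\<integral>\<^sub>0\<^sup>1 t\<^sup>2 \<bar>\<nabla>u(tx)\<bar> dt)\<^sup>2 + R\<^sup>-\<^sup>4\<close>, whose integral over the shell tends to 0.  Hence
  \<open>\<nabla>u = 0\<close>, and the bound \<open>K / \<rho>\<close> on mollifications kills the constants.
\<close>

section \<open>Partial derivatives\<close>

text \<open>\<open>deriv\<close> takes an unspecified value where no derivative exists, so the
  calculus runs on this relation with an explicit derivative function. It composes along sums,
  products and chains, and \<open>partial_eqI\<close> converts back to
  \<open>partial\<close>.\<close>

definition has_partial :: "3 \<Rightarrow> (real^3 \<Rightarrow> real) \<Rightarrow> (real^3 \<Rightarrow> real) \<Rightarrow> bool" where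
  "has_partial j g D \<longleftrightarrow>
     (\<forall>x. ((\<lambda>t. g (x + t *\<^sub>R axis j 1)) has_real_derivative D x) (at 0))"

lemma has_partialI:
  assumes "\<And>x. ((\<lambda>t. g (x + t *\<^sub>R axis j 1)) has_real_derivative D x) (at 0)"
  shows "has_partial j g D"
  using assms by (simp add: has_partial_def)

lemma has_partialD:
  "has_partial j g D \<Longrightarrow> ((\<lambda>t. g (x + t *\<^sub>R axis j 1)) has_real_derivative D x) (at 0)"
  by (simp add: has_partial_def)

lemma partial_eqI: "has_partial j g D \<Longrightarrow> partial j g = D"
  by (auto simp: has_partial_def partial_def fun_eq_iff intro!: DERIV_imp_deriv)

lemma has_partial_along:
  assumes "has_partial j g D"
  shows "((\<lambda>t. g (x + t *\<^sub>R axis j 1)) has_real_derivative D (x + t *\<^sub>R axis j 1)) (at t within S)"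
proof -
  have "((\<lambda>s. g ((x + t *\<^sub>R axis j 1) + s *\<^sub>R axis j 1)) has_real_derivative D (x + t *\<^sub>R axis j 1)) (at 0)"
    using assms by (rule has_partialD)
  then have "((\<lambda>s. g (x + (s + t) *\<^sub>R axis j 1)) has_real_derivative D (x + t *\<^sub>R axis j 1)) (at 0)"
    by (simp add: algebra_simps)
  then show ?thesis
    using DERIV_shift[of "\<lambda>s. g (x + s *\<^sub>R axis j 1)" "D (x + t *\<^sub>R axis j 1)" 0 t]
    by (simp add: has_field_derivative_at_within)
qed

lemma has_partial_const: "has_partial j (\<lambda>x. c) (\<lambda>x. 0)"
  by (auto intro!: has_partialI)

lemma has_partial_coord: "has_partial j (\<lambda>x. x $ k) (\<lambda>x. if k = j then 1 else 0)"
  by (rule has_partialI) (auto simp: axis_def intro!: derivative_eq_intros)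

lemma has_partial_add:
  "has_partial j f F \<Longrightarrow> has_partial j g G \<Longrightarrow> has_partial j (\<lambda>x. f x + g x) (\<lambda>x. F x + G x)"
  by (intro has_partialI DERIV_add) (simp_all add: has_partialD)

lemma has_partial_diff:
  "has_partial j f F \<Longrightarrow> has_partial j g G \<Longrightarrow> has_partial j (\<lambda>x. f x - g x) (\<lambda>x. F x - G x)"
  by (intro has_partialI DERIV_diff) (simp_all add: has_partialD)

lemma has_partial_mult:
  assumes "has_partial j f F" "has_partial j g G"
  shows "has_partial j (\<lambda>x. f x * g x) (\<lambda>x. F x * g x + f x * G x)"
proof (rule has_partialI)
  fix x
  show "((\<lambda>t. f (x + t *\<^sub>R axis j 1) * g (x + t *\<^sub>R axis j 1)) has_real_derivative F x * g x + f x * G x) (at 0)"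
    using DERIV_mult[OF has_partialD[OF assms(1), of x] has_partialD[OF assms(2), of x]]
    by (simp add: algebra_simps)
qed

lemma has_partial_sum:
  assumes "\<And>k. k \<in> K \<Longrightarrow> has_partial j (f k) (F k)"
  shows "has_partial j (\<lambda>x. \<Sum>k\<in>K. f k x) (\<lambda>x. \<Sum>k\<in>K. F k x)"
  by (intro has_partialI DERIV_sum) (rule has_partialD, erule assms)

lemma has_partial_chain:
  assumes "\<And>y. (h has_real_derivative h' y) (at y)" "has_partial j g G"
  shows "has_partial j (\<lambda>x. h (g x)) (\<lambda>x. h' (g x) * G x)"
proof (rule has_partialI)
  fix x
  show "((\<lambda>t. h (g (x + t *\<^sub>R axis j 1))) has_real_derivative h' (g x) * G x) (at 0)"
    using DERIV_chain2[where f = h and g = "\<lambda>t. g (x + t *\<^sub>R axis j 1)" and x = 0, OF _ has_partialD[OF assms(2)]]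
      assms(1) by simp
qed

lemma has_partial_affine:
  assumes "has_partial j g G"
  shows "has_partial j (\<lambda>x. g (s *\<^sub>R x + v)) (\<lambda>x. s * G (s *\<^sub>R x + v))"
proof (rule has_partialI)
  fix x
  have "((\<lambda>t. g ((s *\<^sub>R x + v) + (s * t) *\<^sub>R axis j 1)) has_real_derivative G (s *\<^sub>R x + v) * s) (at 0)"
    using DERIV_chain2[where f = "\<lambda>t. g ((s *\<^sub>R x + v) + t *\<^sub>R axis j 1)" and g = "\<lambda>t. s * t" and x = 0 and Db = s,
        OF _ DERIV_cmult_Id] has_partialD[OF assms, of "s *\<^sub>R x + v"] by simp
  then show "((\<lambda>t. g (s *\<^sub>R (x + t *\<^sub>R axis j 1) + v)) has_real_derivative s * G (s *\<^sub>R x + v)) (at 0)"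
    by (simp add: algebra_simps)
qed

lemma has_partial_inner: "has_partial j (\<lambda>x. x \<bullet> x) (\<lambda>x. 2 * x $ j)"
proof -
  have "has_partial j (\<lambda>x. \<Sum>k\<in>UNIV. x $ k * x $ k)
      (\<lambda>x. \<Sum>k\<in>UNIV. (if k = j then 1 else 0) * x $ k + x $ k * (if k = j then 1 else 0))"
    by (intro has_partial_sum has_partial_mult has_partial_coord)
  then show ?thesis
    by (simp add: inner_vec_def sum.distrib if_distrib[of "\<lambda>c. c * _"] if_distrib[of "\<lambda>c. _ * c"] cong: if_cong)
qed

section \<open>Mean value steps, total derivatives and symmetry of mixed derivatives\<close>

lemma mvt_line:
  fixes F D :: "real \<Rightarrow> real"
  assumes "\<And>t. (F has_real_derivative D t) (at t)"
  obtains s where "\<bar>s\<bar> \<le> \<bar>h\<bar>" "F h - F 0 = h * D s"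
proof (cases "h = 0")
  case True
  then show ?thesis using that[of 0] by simp
next
  case False
  then consider "0 < h" | "h < 0" by linarith
  then show ?thesis
  proof cases
    case 1
    from MVT2[OF 1, of F D] assms obtain z where "0 < z" "z < h" "F h - F 0 = (h - 0) * D z" by auto
    then show ?thesis using that[of z] by auto
  next
    case 2
    from MVT2[OF 2, of F D] assms obtain z where "h < z" "z < 0" "F 0 - F h = (0 - h) * D z" by auto
    then show ?thesis using that[of z] by (auto simp: algebra_simps)
  qed
qed

lemma norm_scaleR_axis: "norm (t *\<^sub>R (axis j 1 :: real^3)) = \<bar>t\<bar>"
  by simp

text \<open>The increment from \<open>x\<close> to \<open>y\<close> is split along three edges
  parallel to the axes. The mean value theorem on each edge gives a partial derivative at a nearby
  point, and continuity of the partial derivatives at \<open>x\<close> controls the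
  discrepancy.\<close>

lemma has_derivative_partials:
  fixes g :: "real^3 \<Rightarrow> real"
  assumes part: "\<And>j. has_partial j g (D j)" and cont: "\<And>j. continuous_on UNIV (D j)"
  shows "(g has_derivative (\<lambda>h. \<Sum>j\<in>UNIV. D j x * h $ j)) (at x)"
proof (rule has_derivativeI)
  show "bounded_linear (\<lambda>h. \<Sum>j\<in>UNIV. D j x * h $ j)"
    by (intro bounded_linear_sum bounded_linear_mult_right[THEN bounded_linear_compose] bounded_linear_vec_nth)
next
  let ?L = "\<lambda>h. \<Sum>j\<in>UNIV. D j x * h $ j"
  show "((\<lambda>y. (g y - g x - ?L (y - x)) /\<^sub>R norm (y - x)) \<longlongrightarrow> 0) (at x)"
  proof (rule tendstoI)
    fix e :: real assume "e > 0"
    \<comment> \<open>Three edges contribute \<open>e / 4\<close> each, which leaves the strict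
      inequality \<open>3 * (e / 4) < e\<close>.\<close>
    have "\<exists>d>0. \<forall>y. dist y x < d \<longrightarrow> dist (D j y) (D j x) < e / 4" for j
      using cont[of j] \<open>e > 0\<close> unfolding continuous_on_iff by (metis UNIV_I divide_pos_pos zero_less_numeral)
    then obtain d where d: "\<And>j. d j > 0" "\<And>j y. dist y x < d j \<Longrightarrow> \<bar>D j y - D j x\<bar> < e / 4"
      unfolding dist_real_def by metis
    \<comment> \<open>An edge starts within \<open>2 * norm h\<close> of \<open>x\<close> and has
      length at most \<open>norm h\<close>, so its points stay within
      \<open>3 * norm h < 3 * r\<close>.\<close>
    define r where "r = Min (range d) / 3"
    have rd: "3 * r \<le> d j" "r > 0" for j
      using d(1) by (auto simp: r_def)
    have key: "\<bar>g y - g x - ?L (y - x)\<bar> \<le> 3 * (e / 4) * norm (y - x)" if y: "dist y x < r" for y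
    proof -
      define h where "h = y - x"
      have hj: "\<bar>h $ j\<bar> \<le> norm h" for j by (rule component_le_norm_cart)
      have nh: "norm h < r" using y by (simp add: h_def dist_norm)
      have step: "\<bar>g (z + h $ j *\<^sub>R axis j 1) - g z - D j x * h $ j\<bar> \<le> e / 4 * norm h"
        if z: "norm (z - x) \<le> 2 * norm h" for z j
      proof -
        obtain s where s: "\<bar>s\<bar> \<le> \<bar>h $ j\<bar>"
            "g (z + h $ j *\<^sub>R axis j 1) - g (z + 0 *\<^sub>R axis j 1) = h $ j * D j (z + s *\<^sub>R axis j 1)"
          by (rule mvt_line[OF has_partial_along[OF part[of j], of z], of "h $ j"])
        have "norm (z + s *\<^sub>R axis j 1 - x) \<le> norm (z - x) + norm (s *\<^sub>R (axis j 1 :: real^3))"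
          by (metis add_diff_eq add.commute norm_triangle_ineq add_diff_eq)
        also have "\<dots> < 3 * r" using z s(1) hj[of j] nh unfolding norm_scaleR_axis by linarith
        finally have "dist (z + s *\<^sub>R axis j 1) x < d j" using rd(1)[of j] by (simp add: dist_norm)
        then have *: "\<bar>D j (z + s *\<^sub>R axis j 1) - D j x\<bar> \<le> e / 4" using d(2) by force
        have "g (z + h $ j *\<^sub>R axis j 1) - g z - D j x * h $ j
            = (D j (z + s *\<^sub>R axis j 1) - D j x) * h $ j"
          using s(2) by (simp add: algebra_simps)
        then show ?thesis
          using mult_mono[OF * hj[of j]] \<open>e > 0\<close> by (simp add: abs_mult)
      qed
      let ?z1 = "x + h $ 1 *\<^sub>R axis 1 1" and ?z2 = "x + h $ 1 *\<^sub>R axis 1 1 + h $ 2 *\<^sub>R axis 2 1"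
      have z1: "norm (?z1 - x) \<le> 2 * norm h"
        using hj[of 1] norm_scaleR_axis[of "h $ 1" 1] by simp
      have z2: "norm (?z2 - x) \<le> 2 * norm h"
        using norm_triangle_ineq[of "h $ 1 *\<^sub>R (axis 1 1 :: real^3)" "h $ 2 *\<^sub>R axis 2 1"] hj[of 1] hj[of 2]
        unfolding norm_scaleR_axis by (simp add: add.assoc)
      have "?z2 + h $ 3 *\<^sub>R axis 3 1 = y"
        by (simp add: vec_eq_iff forall_3 axis_def h_def)
      then show ?thesis
        using step[of x 1] step[OF z1, of 2] step[OF z2, of 3]
        unfolding h_def[symmetric] sum_3 abs_le_iff by (auto simp: algebra_simps)
    qed
    show "\<forall>\<^sub>F y in at x. dist ((g y - g x - ?L (y - x)) /\<^sub>R norm (y - x)) 0 < e"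
      unfolding eventually_at
    proof (intro exI[of _ r] conjI ballI impI rd(2))
      fix y assume y: "y \<noteq> x \<and> dist y x < r"
      then have "\<bar>g y - g x - ?L (y - x)\<bar> \<le> 3 * (e / 4) * norm (y - x)" by (intro key) auto
      moreover have "0 < norm (y - x)" using y by simp
      ultimately have "\<bar>g y - g x - ?L (y - x)\<bar> / norm (y - x) \<le> 3 * (e / 4)"
        by (simp add: divide_le_eq)
      also have "\<dots> < e" using \<open>e > 0\<close> by simp
      finally show "dist ((g y - g x - ?L (y - x)) /\<^sub>R norm (y - x)) 0 < e"
        by (simp add: divideR_right divide_inverse_commute[symmetric])
    qed
  qed
qed

text \<open>The second difference of \<open>g\<close> with step \<open>h\<close> in both directions
  does not depend on the order of the directions. Two mean value steps, taken in either order,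
  express it as \<open>h * h\<close> times one or the other mixed derivative at a point near
  \<open>x\<close>, and continuity forces the two values at \<open>x\<close> to agree.\<close>

lemma partials_commute:
  fixes g :: "real^3 \<Rightarrow> real"
  assumes i: "has_partial i g Gi" and j: "has_partial j g Gj"
    and ij: "has_partial j Gi Gij" and ji: "has_partial i Gj Gji"
    and cij: "continuous_on UNIV Gij" and cji: "continuous_on UNIV Gji"
  shows "Gij x = Gji x"
proof -
  let ?a = "axis i 1 :: real^3" and ?b = "axis j 1 :: real^3"
  have twice: "\<exists>s t. \<bar>s\<bar> \<le> \<bar>h\<bar> \<and> \<bar>t\<bar> \<le> \<bar>h\<bar> \<and>
      g (x + h *\<^sub>R axis k 1 + h *\<^sub>R axis l 1) - g (x + h *\<^sub>R axis k 1) - g (x + h *\<^sub>R axis l 1) + g x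
        = h * h * Gkl (x + s *\<^sub>R axis k 1 + t *\<^sub>R axis l 1)"
    if k: "has_partial k g Gk" and kl: "has_partial l Gk Gkl" for h k l Gk Gkl
  proof -
    have "((\<lambda>s. g (x + h *\<^sub>R axis l 1 + s *\<^sub>R axis k 1) - g (x + s *\<^sub>R axis k 1)) has_real_derivative
        Gk (x + h *\<^sub>R axis l 1 + s *\<^sub>R axis k 1) - Gk (x + s *\<^sub>R axis k 1)) (at s)" for s
      by (intro DERIV_diff has_partial_along k)
    then obtain s where s: "\<bar>s\<bar> \<le> \<bar>h\<bar>"
      "g (x + h *\<^sub>R axis l 1 + h *\<^sub>R axis k 1) - g (x + h *\<^sub>R axis k 1)
        - (g (x + h *\<^sub>R axis l 1 + 0 *\<^sub>R axis k 1) - g (x + 0 *\<^sub>R axis k 1))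
       = h * (Gk (x + h *\<^sub>R axis l 1 + s *\<^sub>R axis k 1) - Gk (x + s *\<^sub>R axis k 1))"
      by (rule mvt_line)
    obtain t where t: "\<bar>t\<bar> \<le> \<bar>h\<bar>"
      "Gk (x + s *\<^sub>R axis k 1 + h *\<^sub>R axis l 1) - Gk (x + s *\<^sub>R axis k 1 + 0 *\<^sub>R axis l 1)
        = h * Gkl (x + s *\<^sub>R axis k 1 + t *\<^sub>R axis l 1)"
      by (rule mvt_line[OF has_partial_along[OF kl]])
    show ?thesis
      using s t by (intro exI[of _ s] exI[of _ t]) (simp add: algebra_simps)
  qed
  show ?thesis
  proof (rule ccontr)
    assume "Gij x \<noteq> Gji x"
    then have e: "0 < \<bar>Gij x - Gji x\<bar> / 2" by simp
    let ?e = "\<bar>Gij x - Gji x\<bar> / 2"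
    obtain d1 where d1: "d1 > 0" "\<And>y. dist y x < d1 \<Longrightarrow> \<bar>Gij y - Gij x\<bar> < ?e"
      using cij e unfolding continuous_on_iff dist_real_def by (metis UNIV_I)
    obtain d2 where d2: "d2 > 0" "\<And>y. dist y x < d2 \<Longrightarrow> \<bar>Gji y - Gji x\<bar> < ?e"
      using cji e unfolding continuous_on_iff dist_real_def by (metis UNIV_I)
    \<comment> \<open>The intermediate points lie within \<open>2 * h\<close> of \<open>x\<close>,
      which is below both radii of continuity.\<close>
    define h where "h = min d1 d2 / 4"
    have h: "h > 0" "2 * h < d1" "2 * h < d2" using d1(1) d2(1) by (auto simp: h_def min_def)
    obtain s t where st: "\<bar>s\<bar> \<le> \<bar>h\<bar>" "\<bar>t\<bar> \<le> \<bar>h\<bar>"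
      "g (x + h *\<^sub>R ?a + h *\<^sub>R ?b) - g (x + h *\<^sub>R ?a) - g (x + h *\<^sub>R ?b) + g x
        = h * h * Gij (x + s *\<^sub>R ?a + t *\<^sub>R ?b)"
      using twice[OF i ij] by blast
    obtain s' t' where st': "\<bar>s'\<bar> \<le> \<bar>h\<bar>" "\<bar>t'\<bar> \<le> \<bar>h\<bar>"
      "g (x + h *\<^sub>R ?b + h *\<^sub>R ?a) - g (x + h *\<^sub>R ?b) - g (x + h *\<^sub>R ?a) + g x
        = h * h * Gji (x + s' *\<^sub>R ?b + t' *\<^sub>R ?a)"
      using twice[OF j ji] by blast
    have "g (x + h *\<^sub>R ?b + h *\<^sub>R ?a) = g (x + h *\<^sub>R ?a + h *\<^sub>R ?b)"
      by (simp add: algebra_simps)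
    with st(3) st'(3) have "h * h * Gij (x + s *\<^sub>R ?a + t *\<^sub>R ?b) = h * h * Gji (x + s' *\<^sub>R ?b + t' *\<^sub>R ?a)"
      by linarith
    then have eq: "Gij (x + s *\<^sub>R ?a + t *\<^sub>R ?b) = Gji (x + s' *\<^sub>R ?b + t' *\<^sub>R ?a)"
      using h(1) by simp
    have near: "dist (x + a *\<^sub>R axis k 1 + b *\<^sub>R axis l 1) x \<le> 2 * h"
      if "\<bar>a\<bar> \<le> \<bar>h\<bar>" "\<bar>b\<bar> \<le> \<bar>h\<bar>" for a b and k l :: 3
      using that norm_triangle_ineq[of "a *\<^sub>R (axis k 1 :: real^3)" "b *\<^sub>R axis l 1"] h(1)
      unfolding norm_scaleR_axis by (simp add: dist_norm add.assoc)
    have "\<bar>Gij (x + s *\<^sub>R ?a + t *\<^sub>R ?b) - Gij x\<bar> < ?e"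
      using near[OF st(1,2), of i j] h(2) by (intro d1(2)) linarith
    moreover have "\<bar>Gji (x + s' *\<^sub>R ?b + t' *\<^sub>R ?a) - Gji x\<bar> < ?e"
      using near[OF st'(1,2), of j i] h(3) by (intro d2(2)) linarith
    ultimately show False using eq unfolding abs_less_iff by (auto simp: abs_if split: if_splits)
  qed
qed

section \<open>Smooth functions and their derivatives\<close>

lemma pderivs_append: "pderivs (js @ ks) g = pderivs js (pderivs ks g)"
  by (induction js) auto

lemma smooth_fun_has_partial:
  assumes "smooth_fun g"
  shows "has_partial j g (partial j g)"
proof (rule has_partialI)
  fix x
  have "(\<lambda>t. pderivs [] g (x + t *\<^sub>R axis j 1)) differentiable (at 0)"
    using assms unfolding smooth_fun_def by blast
  then show "((\<lambda>t. g (x + t *\<^sub>R axis j 1)) has_real_derivative partial j g x) (at 0)"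
    by (simp add: partial_def DERIV_deriv_iff_real_differentiable)
qed

lemma smooth_fun_partial:
  assumes "smooth_fun g" shows "smooth_fun (partial j g)"
  unfolding smooth_fun_def
proof
  fix js
  have "pderivs js (partial j g) = pderivs (js @ [j]) g" by (simp add: pderivs_append)
  then show "continuous_on UNIV (pderivs js (partial j g)) \<and>
      (\<forall>k x. (\<lambda>t. pderivs js (partial j g) (x + t *\<^sub>R axis k 1)) differentiable (at 0))"
    using assms unfolding smooth_fun_def by metis
qed

lemma smooth_fun_continuous: "smooth_fun g \<Longrightarrow> continuous_on UNIV g"
  unfolding smooth_fun_def by (metis pderivs.simps(1))

lemma smooth_fun_has_derivative:
  assumes "smooth_fun g"
  shows "(g has_derivative (\<lambda>h. \<Sum>j\<in>UNIV. partial j g x * h $ j)) (at x)"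
  by (rule has_derivative_partials[where D = "\<lambda>j. partial j g"])
    (auto intro: smooth_fun_has_partial smooth_fun_continuous smooth_fun_partial assms)

lemma smooth_fun_along_line:
  assumes "smooth_fun g"
  shows "((\<lambda>t. g (x + t *\<^sub>R h)) has_real_derivative (\<Sum>j\<in>UNIV. partial j g (x + t *\<^sub>R h) * h $ j)) (at t within S)"
proof -
  have "((\<lambda>t. x + t *\<^sub>R h) has_derivative (\<lambda>s. s *\<^sub>R h)) (at t within S)"
    by (auto intro!: derivative_eq_intros)
  from has_derivative_compose[OF this smooth_fun_has_derivative[OF assms]]
  moreover have "(\<lambda>s. \<Sum>j\<in>UNIV. partial j g (x + t *\<^sub>R h) * (s *\<^sub>R h) $ j)
      = (*) (\<Sum>j\<in>UNIV. partial j g (x + t *\<^sub>R h) * h $ j)"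
    by (simp add: fun_eq_iff sum_distrib_left mult_ac)
  ultimately show ?thesis by (simp add: has_field_derivative_def)
qed

lemma partials_commute_smooth:
  "smooth_fun g \<Longrightarrow> partial i (partial j g) x = partial j (partial i g) x"
  by (rule partials_commute[where g = g and i = j and j = i and Gi = "partial j g" and Gj = "partial i g"])
    (auto intro: smooth_fun_has_partial smooth_fun_partial smooth_fun_continuous)

text \<open>The strict inequality makes the region outside the ball open, so short coordinate
  segments around \<open>x\<close> stay in it and \<open>g\<close> is locally zero along
  them.\<close>

lemma has_partial_vanishes:
  assumes part: "has_partial j g D" and supp: "\<And>x. norm x > r \<Longrightarrow> g x = 0" and x: "norm x > r"
  shows "D x = 0"
proof -
  have "continuous (at 0) (\<lambda>t. norm (x + t *\<^sub>R axis j 1))" by (intro continuous_intros)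
  then have "((\<lambda>t. norm (x + t *\<^sub>R axis j 1)) \<longlongrightarrow> norm x) (at 0)"
    by (simp add: continuous_at)
  then have "\<forall>\<^sub>F t in at 0. norm (x + t *\<^sub>R axis j 1) > r"
    using x by (auto intro: order_tendstoD)
  then have "\<forall>\<^sub>F t in nhds 0. norm (x + t *\<^sub>R axis j 1) > r"
    using x by (simp add: eventually_nhds_conv_at)
  then have "\<forall>\<^sub>F t in nhds 0. g (x + t *\<^sub>R axis j 1) = 0"
    by (rule eventually_mono) (rule supp)
  then have "((\<lambda>t. g (x + t *\<^sub>R axis j 1)) has_real_derivative 0) (at 0)"
    by (subst DERIV_cong_ev[of 0 0 _ "\<lambda>t. 0" 0 0]) auto
  then show ?thesis using has_partialD[OF part, of x] DERIV_unique by blast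
qed

section \<open>Continuous functions of compact support and vanishing integrals of
  derivatives\<close>

lemma continuous_compact_support_bounded:
  fixes g :: "'a::euclidean_space \<Rightarrow> real"
  assumes cont: "continuous_on UNIV g" and supp: "\<And>x. norm x > r \<Longrightarrow> g x = 0"
  obtains M where "M > 0" "\<And>x. \<bar>g x\<bar> \<le> M"
proof -
  have "bounded (g ` cball 0 r)"
    by (intro compact_imp_bounded compact_continuous_image continuous_on_subset[OF cont]) auto
  then obtain B where B: "\<And>x. norm x \<le> r \<Longrightarrow> \<bar>g x\<bar> \<le> B" unfolding bounded_iff by fastforce
  have "\<bar>g x\<bar> \<le> \<bar>B\<bar> + 1" for x
    using B[of x] supp[of x] by (cases "norm x \<le> r") auto
  then show ?thesis by (intro that[of "\<bar>B\<bar> + 1"]) auto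
qed

lemma integrable_continuous_compact_support:
  fixes g :: "'a::euclidean_space \<Rightarrow> real"
  assumes "continuous_on UNIV g" "\<And>x. norm x > r \<Longrightarrow> g x = 0"
  shows "integrable lborel g"
proof -
  have "integrable lborel (\<lambda>x. indicator (cball 0 r) x *\<^sub>R g x)"
    using borel_integrable_compact[of "cball 0 r" g] continuous_on_subset[OF assms(1)]
    by (auto simp: if_distrib indicator_def cong: if_cong)
  moreover have "(\<lambda>x. indicator (cball 0 r) x *\<^sub>R g x) = g"
    using assms(2) by (auto simp: fun_eq_iff indicator_def not_le)
  ultimately show ?thesis by simp
qed

text \<open>Translation invariance makes every difference quotient of \<open>g\<close> integrate to
  zero, and dominated convergence passes this on to the derivative. This is the form in which
  integration by parts enters below.\<close>

lemma integral_partial_eq_0: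
  fixes g :: "real^3 \<Rightarrow> real"
  assumes part: "has_partial j g D" and contg: "continuous_on UNIV g" and cont: "continuous_on UNIV D"
    and supp: "\<And>x. norm x > r \<Longrightarrow> g x = 0"
  shows "integrable lborel D" "(\<integral>x. D x \<partial>lborel) = 0"
proof -
  have borelg[measurable]: "g \<in> borel_measurable borel" "D \<in> borel_measurable borel"
    using contg cont by (auto intro: borel_measurable_continuous_onI)
  have suppD: "D x = 0" if "norm x > r" for x
    using has_partial_vanishes[OF part] supp that by blast
  obtain N where DN: "N > 0" "\<And>x. \<bar>D x\<bar> \<le> N"
    using continuous_compact_support_bounded[OF cont suppD] by blast
  have fin: "integrable lborel (\<lambda>x. N * indicator (cball 0 R) x :: real)" for R
    using emeasure_lborel_cball_finite[of 0 R]
    by (intro integrable_mult_right integrable_real_indicator) auto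
  show "integrable lborel D" using cont suppD by (rule integrable_continuous_compact_support)
  have intg: "integrable lborel g" using contg supp by (rule integrable_continuous_compact_support)
  \<comment> \<open>The step \<open>1 / real (Suc n)\<close> is never zero and at most 1.\<close>
  define q where "q n x = real (Suc n) * (g (x + (1 / real (Suc n)) *\<^sub>R axis j 1) - g x)" for n x
  have shift: "integrable lborel (\<lambda>x. g (x + a))" "(\<integral>x. g (x + a) \<partial>lborel) = (\<integral>x. g x \<partial>lborel)" for a
  proof -
    have eq: "lborel = distr lborel borel (\<lambda>x::real^3. a + x)" by (simp add: lborel_distr_plus)
    show "(\<integral>x. g (x + a) \<partial>lborel) = (\<integral>x. g x \<partial>lborel)"
      by (subst (2) eq, subst integral_distr) (auto simp: add.commute)
    show "integrable lborel (\<lambda>x. g (x + a))"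
      using intg by (subst (asm) eq, subst (asm) integrable_distr_eq) (auto simp: add.commute)
  qed
  have q0: "(\<integral>x. q n x \<partial>lborel) = 0" for n
    unfolding q_def using shift intg by simp
  have lim: "(\<lambda>n. \<integral>x. q n x \<partial>lborel) \<longlonglongrightarrow> (\<integral>x. D x \<partial>lborel)"
  \<comment> \<open>By the mean value theorem \<open>q n x\<close> is a value of \<open>D\<close> at
    distance at most 1 from \<open>x\<close>. Hence it is bounded by \<open>N\<close>, and it
    vanishes outside the ball of radius \<open>r + 1\<close>.\<close>
  proof (rule integral_dominated_convergence[where w = "\<lambda>x. N * indicator (cball 0 (r + 1)) x"])
    show "AE x in lborel. (\<lambda>n. q n x) \<longlonglongrightarrow> D x"
    proof (intro AE_I2)
      fix x
      have "((\<lambda>h. (g (x + h *\<^sub>R axis j 1) - g x) / h) \<longlongrightarrow> D x) (at 0)"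
        using has_partialD[OF part, of x] by (simp add: DERIV_def)
      moreover have "filterlim (\<lambda>n. 1 / real (Suc n)) (at 0) sequentially"
        using LIMSEQ_inverse_real_of_nat
        by (auto simp: filterlim_at inverse_eq_divide intro!: always_eventually)
      ultimately have "(\<lambda>n. (g (x + (1 / real (Suc n)) *\<^sub>R axis j 1) - g x) / (1 / real (Suc n))) \<longlonglongrightarrow> D x"
        by (rule filterlim_compose)
      then show "(\<lambda>n. q n x) \<longlonglongrightarrow> D x" by (simp add: q_def mult.commute)
    qed
    show "AE x in lborel. norm (q n x) \<le> N * indicator (cball 0 (r + 1)) x" for n
    proof (intro AE_I2)
      fix x :: "real^3"
      let ?h = "1 / real (Suc n)"
      have h: "\<bar>?h\<bar> \<le> 1" by simp
      obtain s where s: "\<bar>s\<bar> \<le> \<bar>?h\<bar>"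
        "g (x + ?h *\<^sub>R axis j 1) - g (x + 0 *\<^sub>R axis j 1) = ?h * D (x + s *\<^sub>R axis j 1)"
        by (rule mvt_line[OF has_partial_along[OF part, of x], of ?h])
      have qs: "q n x = D (x + s *\<^sub>R axis j 1)" using s(2) by (simp add: q_def)
      show "norm (q n x) \<le> N * indicator (cball 0 (r + 1)) x"
      proof (cases "norm x \<le> r + 1")
        case True
        then show ?thesis using DN(2) qs by simp
      next
        case False
        have "norm x \<le> norm (x + s *\<^sub>R axis j 1) + \<bar>s\<bar>"
          using norm_triangle_ineq4[of "x + s *\<^sub>R axis j 1" "s *\<^sub>R axis j 1"] by simp
        then have "norm (x + s *\<^sub>R axis j 1) > r" using False s(1) h by linarith
        then show ?thesis using qs suppD DN(1) by simp
      qed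
    qed
  next
    show "integrable lborel (\<lambda>x. N * indicator (cball 0 (r + 1)) x :: real)" by (rule fin)
  qed (simp_all add: q_def)
  then show "(\<integral>x. D x \<partial>lborel) = 0" by (simp add: q0 LIMSEQ_const_iff)
qed

text \<open>Otherwise a nonempty open set, where \<open>f\<close> is nonzero, would have measure
  zero.\<close>

lemma continuous_AE_eq_0:
  fixes f :: "'a::euclidean_space \<Rightarrow> real"
  assumes cont: "continuous_on UNIV f" and ae: "AE x in lborel. f x = 0"
  shows "f x = 0"
proof (rule ccontr)
  assume "f x \<noteq> 0"
  have "{x \<in> space lborel. \<not> f x = 0} \<in> sets lborel"
    using borel_measurable_continuous_onI[OF cont] by measurable
  then have "emeasure lborel {x \<in> space lborel. \<not> f x = 0} = 0"
    using AE_iff_measurable[OF _ refl, of lborel "\<lambda>x. f x = 0"] ae by simp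
  then have "emeasure lborel {x. f x \<noteq> 0} = 0" by simp
  moreover have "open {x. f x \<noteq> 0}"
    using open_Collect_neq[OF cont continuous_on_const] by simp
  ultimately have "{x. f x \<noteq> 0} = {}"
    using open_not_negligible negligible_iff_emeasure0 by (metis borel_open emeasure_completion null_setsI null_sets_completionI sets_lborel negligible_iff_null_sets)
  then show False using \<open>f x \<noteq> 0\<close> by auto
qed

section \<open>A smooth mollifier\<close>

text \<open>Smoothness speaks of all iterated derivatives. A class of continuous functions closed
  under partial derivatives contains every iterated derivative of its members, so none of them has
  to be computed.\<close>

lemma smooth_funI_closed:
  assumes "S g"
    and cont: "\<And>f. S f \<Longrightarrow> continuous_on UNIV f"
    and step: "\<And>f j. S f \<Longrightarrow> \<exists>f'. S f' \<and> has_partial j f f'"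
  shows "smooth_fun g"
proof -
  have S: "S (pderivs js g)" for js
  proof (induction js)
    case (Cons j js)
    then obtain f' where "S f'" "has_partial j (pderivs js g) f'" using step by blast
    then show ?case by (simp add: partial_eqI)
  qed (simp add: assms(1))
  show ?thesis
    unfolding smooth_fun_def
  proof (intro allI conjI cont S)
    fix js j x
    obtain f' where "has_partial j (pderivs js g) f'" using step[OF S] by blast
    then show "(\<lambda>t. pderivs js g (x + t *\<^sub>R axis j 1)) differentiable at 0"
      using has_partialD real_differentiable_def by blast
  qed
qed

text \<open>The powers of \<open>inverse t\<close> in front of the classical flat function
  \<open>exp (- inverse t)\<close> make the linear span of the family closed under
  differentiation.\<close>

definition flat :: "nat \<Rightarrow> real \<Rightarrow> real" where
  "flat k t = (if 0 < t then inverse t ^ k * exp (- inverse t) else 0)"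

lemma flat_tendsto_0: "(flat k \<longlongrightarrow> 0) (at_right 0)"
proof -
  have "((\<lambda>t. inverse t ^ k / exp (inverse t)) \<longlongrightarrow> 0) (at_right (0::real))"
    using tendsto_power_div_exp_0 filterlim_inverse_at_top_right by (rule filterlim_compose)
  moreover have "\<forall>\<^sub>F t in at_right 0. inverse t ^ k / exp (inverse t) = flat k t"
    by (auto simp: eventually_at_right_less flat_def exp_minus divide_inverse intro!: eventually_at_right_less[THEN eventually_mono])
  ultimately show ?thesis by (rule Lim_transform_eventually)
qed

text \<open>Away from 0 this is the product rule. At 0 the left difference quotient is zero and the
  right one is \<open>flat (Suc k)\<close>, which tends to 0 because exponentials beat
  powers.\<close>

lemma DERIV_flat: "(flat k has_real_derivative flat (k + 2) t - real k * flat (k + 1) t) (at t)"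
proof -
  consider "t < 0" | "t = 0" | "t > 0" by linarith
  then show ?thesis
  proof cases
    case 1
    then have "\<forall>\<^sub>F s in nhds t. flat k s = 0"
      using eventually_nhds_in_open[of "{..<0}" t] by (auto simp: flat_def elim!: eventually_mono)
    then have "(flat k has_real_derivative 0) (at t)"
      by (subst DERIV_cong_ev[of t t _ "\<lambda>t. 0" 0 0]) auto
    then show ?thesis using 1 by (simp add: flat_def)
  next
    case 2
    have "((\<lambda>h. (flat k (0 + h) - flat k 0) / h) \<longlongrightarrow> 0) (at 0)"
      unfolding filterlim_at_split
    proof
      have "\<forall>\<^sub>F h in at_left 0. 0 = (flat k (0 + h) - flat k 0) / h"
        by (auto simp: eventually_at_filter flat_def)
      then show "((\<lambda>h. (flat k (0 + h) - flat k 0) / h) \<longlongrightarrow> 0) (at_left 0)"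
        by (rule Lim_transform_eventually[OF tendsto_const])
      have "\<forall>\<^sub>F h in at_right 0. flat (Suc k) h = (flat k (0 + h) - flat k 0) / h"
        by (auto simp: eventually_at_filter flat_def divide_inverse)
      then show "((\<lambda>h. (flat k (0 + h) - flat k 0) / h) \<longlongrightarrow> 0) (at_right 0)"
        by (rule Lim_transform_eventually[OF flat_tendsto_0])
    qed
    then show ?thesis using 2 by (simp add: DERIV_def flat_def)
  next
    case 3
    have "((\<lambda>t. inverse t ^ k * exp (- inverse t)) has_real_derivative
        flat (k + 2) t - real k * flat (k + 1) t) (at t)"
    proof (cases k)
      case 0
      then show ?thesis using 3
        by (auto intro!: derivative_eq_intros simp: flat_def power2_eq_square)
    next
      case (Suc n)
      have inv: "(inverse has_real_derivative - (inverse t)\<^sup>2) (at t)"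
        using DERIV_inverse[of t UNIV] 3 by (simp add: power2_eq_square)
      have "((\<lambda>t. exp (- inverse t)) has_real_derivative exp (- inverse t) * (inverse t)\<^sup>2) (at t)"
        using DERIV_fun_exp[OF DERIV_minus[OF inv]] by simp
      from DERIV_mult[OF DERIV_power_Suc[OF inv, of n] this] show ?thesis
        using 3 Suc by (simp add: flat_def power2_eq_square algebra_simps)
    qed
    moreover have "\<forall>\<^sub>F s in nhds t. flat k s = inverse s ^ k * exp (- inverse s)"
      using eventually_nhds_in_open[of "{0<..}" t] 3 by (auto simp: flat_def elim!: eventually_mono)
    ultimately show ?thesis by (subst DERIV_cong_ev[OF refl _ refl]) auto
  qed
qed

lemma continuous_flat [continuous_intros]:
  "continuous_on S f \<Longrightarrow> continuous_on S (\<lambda>x. flat k (f x))"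
proof -
  have "continuous_on UNIV (flat k)"
    by (intro continuous_at_imp_continuous_on ballI DERIV_isCont[OF DERIV_flat])
  then show "continuous_on S f \<Longrightarrow> continuous_on S (\<lambda>x. flat k (f x))"
    by (rule continuous_on_compose2) auto
qed

text \<open>The algebra generated by flat functions of single coordinates is closed under partial
  derivatives and under the substitutions \<open>s *\<^sub>R y + v\<close>. It therefore delivers
  the smoothness of a bump function and of all its rescalings at once.\<close>

inductive flat_poly :: "(real^3 \<Rightarrow> real) \<Rightarrow> bool" where
  flat_poly_flat: "flat_poly (\<lambda>y. flat k (a * y $ i + b))"
| flat_poly_const: "flat_poly (\<lambda>y. c)"
| flat_poly_add: "flat_poly f \<Longrightarrow> flat_poly g \<Longrightarrow> flat_poly (\<lambda>y. f y + g y)"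
| flat_poly_mult: "flat_poly f \<Longrightarrow> flat_poly g \<Longrightarrow> flat_poly (\<lambda>y. f y * g y)"

lemma flat_poly_partial: "flat_poly f \<Longrightarrow> \<exists>f'. flat_poly f' \<and> has_partial j f f'"
proof (induction rule: flat_poly.induct)
  case (flat_poly_flat k a i b)
  let ?d = "if i = j then a else 0"
  have lin: "has_partial j (\<lambda>y. a * y $ i + b) (\<lambda>y. ?d)"
    by (rule has_partialI) (auto simp: axis_def intro!: derivative_eq_intros)
  have "has_partial j (\<lambda>y. flat k (a * y $ i + b))
      (\<lambda>y. (flat (k + 2) (a * y $ i + b) - real k * flat (k + 1) (a * y $ i + b)) * ?d)"
    by (rule has_partial_chain[OF DERIV_flat lin])
  moreover have "flat_poly (\<lambda>y. (flat (k + 2) (a * y $ i + b) + - real k * flat (k + 1) (a * y $ i + b)) * ?d)"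
    by (intro flat_poly.intros)
  ultimately show ?case by auto
next
  case (flat_poly_const c)
  then show ?case using has_partial_const flat_poly.flat_poly_const by blast
next
  case (flat_poly_add f g)
  then show ?case using has_partial_add flat_poly.flat_poly_add by blast
next
  case (flat_poly_mult f g)
  then obtain f' g' where "flat_poly f'" "has_partial j f f'" "flat_poly g'" "has_partial j g g'" by blast
  then show ?case
    using flat_poly_mult.hyps
    by (intro exI[of _ "\<lambda>x. f' x * g x + f x * g' x"] conjI flat_poly.intros has_partial_mult)
qed

lemma flat_poly_continuous: "flat_poly f \<Longrightarrow> continuous_on UNIV f"
  by (induction rule: flat_poly.induct) (auto intro!: continuous_intros)

lemma flat_poly_smooth: "flat_poly f \<Longrightarrow> smooth_fun f"
  by (rule smooth_funI_closed[where S = flat_poly])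
    (auto intro: flat_poly_continuous flat_poly_partial)

lemma flat_poly_affine: "flat_poly f \<Longrightarrow> flat_poly (\<lambda>y. f (s *\<^sub>R y + v))"
proof (induction rule: flat_poly.induct)
  case (flat_poly_flat k a i b)
  have "flat_poly (\<lambda>y. flat k ((a * s) * y $ i + (a * v $ i + b)))"
    by (rule flat_poly.flat_poly_flat)
  then show ?case by (simp add: algebra_simps)
qed (auto intro: flat_poly.intros)

lemma flat_nonneg: "0 \<le> flat k t"
  by (simp add: flat_def)

text \<open>A product bump on the unit cube, normalized, has these properties. Smoothness is
  asserted for all affine rescalings because these serve as test functions below.\<close>

lemma mollifier_exists:
  obtains \<eta> :: "real^3 \<Rightarrow> real" where
    "\<And>z. 0 \<le> \<eta> z" "\<And>z. norm z > 2 \<Longrightarrow> \<eta> z = 0" "(\<integral>z. \<eta> z \<partial>lborel) = 1"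
    "\<And>s v. smooth_fun (\<lambda>y. \<eta> (s *\<^sub>R y + v))"
proof -
  \<comment> \<open>Each coordinate contributes a factor that is positive exactly on the open unit
    interval. The form \<open>1 * z $ 1 + 0\<close> matches the generators of
    \<open>flat_poly\<close> literally.\<close>
  define b :: "real^3 \<Rightarrow> real" where
    "b = (\<lambda>z. (flat 0 (1 * z $ 1 + 0) * flat 0 ((-1) * z $ 1 + 1)) *
      ((flat 0 (1 * z $ 2 + 0) * flat 0 ((-1) * z $ 2 + 1)) *
       (flat 0 (1 * z $ 3 + 0) * flat 0 ((-1) * z $ 3 + 1))))"
  have fb: "flat_poly b" unfolding b_def by (intro flat_poly.intros)
  have contb: "continuous_on UNIV b" by (rule flat_poly_continuous[OF fb])
  have b0: "0 \<le> b z" for z unfolding b_def by (intro mult_nonneg_nonneg flat_nonneg)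
  have supp: "b z = 0" if "norm z > 2" for z
  proof (rule ccontr)
    assume "b z \<noteq> 0"
    then have "0 < z $ i \<and> z $ i < 1" for i
      using exhaust_3[of i] by (auto simp: b_def flat_def split: if_splits)
    then have "(z $ i)\<^sup>2 \<le> 1" for i by (metis less_eq_real_def power_le_one)
    \<comment> \<open>Points of the unit cube have norm at most \<open>sqrt 3\<close>, so 2 is a
      safe support radius.\<close>
    from this[of 1] this[of 2] this[of 3] have "norm z \<le> sqrt 3"
      unfolding norm_vec_def L2_set_def by (intro real_sqrt_le_mono) (simp add: sum_3)
    also have "\<dots> \<le> 2" by (rule real_le_lsqrt) auto
    finally show False using that by simp
  qed
  have intb: "integrable lborel b"
    using contb supp by (rule integrable_continuous_compact_support)
  define c where "c = (\<integral>z. b z \<partial>lborel)"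
  have "c > 0"
  proof -
    \<comment> \<open>The centre of the cube witnesses that the continuous function \<open>b\<close>
      is not almost everywhere zero.\<close>
    define p :: "real^3" where "p = (\<chi> i. 1/2)"
    have "b p > 0" by (simp add: b_def flat_def p_def)
    have "c \<noteq> 0"
    proof
      assume "c = 0"
      then have "AE z in lborel. b z = 0"
        using integral_nonneg_eq_0_iff_AE[OF intb] b0 by (auto simp: c_def)
      then have "b p = 0" by (rule continuous_AE_eq_0[OF contb])
      then show False using \<open>b p > 0\<close> by simp
    qed
    then show ?thesis using b0 by (simp add: c_def integral_nonneg_AE less_le)
  qed
  show ?thesis
  proof (rule that[of "\<lambda>z. (1 / c) * b z"])
    show "smooth_fun (\<lambda>y. (1 / c) * b (s *\<^sub>R y + v))" for s v
      by (rule flat_poly_smooth[OF flat_poly_mult[OF flat_poly_const flat_poly_affine[OF fb]]])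
  qed (use \<open>c > 0\<close> b0 supp in \<open>auto simp: c_def\<close>)
qed

section \<open>Mollification and bounded mean oscillation\<close>

lemma lborel_integral_affine:
  fixes h :: "'a::euclidean_space \<Rightarrow> real"
  assumes [measurable]: "h \<in> borel_measurable borel" and "c > 0"
  shows "(\<integral>y. h y \<partial>lborel) = c ^ DIM('a) * (\<integral>z. h (t + c *\<^sub>R z) \<partial>lborel)"
  using \<open>c > 0\<close>
  by (subst lborel_affine[of c t]) (simp_all add: integral_density integral_distr)

text \<open>The derivative \<open>D\<close> of a compactly supported function has integral zero, so
  \<open>d\<close> may be replaced by \<open>d - m\<close> with \<open>m\<close> its mean on the
  ball. What remains is at most \<open>M\<close> times the mean oscillation times the
  volume.\<close>

lemma BMO_integral_partial_bound:
  fixes d :: "real^3 \<Rightarrow> real"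
  assumes d: "\<And>x r. r > 0 \<Longrightarrow> set_integrable lborel (ball x r) d"
    and osc: "\<And>x r. r > 0 \<Longrightarrow> avg (\<lambda>y. \<bar>d y - avg d (ball x r)\<bar>) (ball x r) \<le> K"
    and part: "has_partial j g D" and contg: "continuous_on UNIV g" and cont: "continuous_on UNIV D"
    and supp: "\<And>y. y \<notin> ball x r \<Longrightarrow> g y = 0" and r: "r > 0"
    and M: "\<And>y. \<bar>D y\<bar> \<le> M" and suppD: "\<And>y. y \<notin> ball x r \<Longrightarrow> D y = 0"
  shows "\<bar>\<integral>y. d y * D y \<partial>lborel\<bar> \<le> M * K * measure lborel (ball x r)"
proof -
  let ?B = "ball x r"
  define m where "m = avg d ?B"
  have M0: "0 \<le> M" using M[of x] by linarith
  have Bfin: "emeasure lborel ?B < \<infinity>" by (rule emeasure_lborel_ball_finite)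
  have Bpos: "measure lborel ?B > 0" using content_ball_pos[OF r] by simp
  have [measurable]: "D \<in> borel_measurable borel" "?B \<in> sets borel"
    using cont by (auto intro: borel_measurable_continuous_onI)
  have "set_integrable lborel ?B (\<lambda>y. d y - m)"
    using Bfin by (intro set_integral_diff d r) (auto simp: set_integrable_def)
  then have dm: "integrable lborel (\<lambda>y. indicator ?B y * (d y - m))"
    by (simp add: set_integrable_def)
  have eqd: "(d y - m) * D y = (indicator ?B y * (d y - m)) * D y" for y
    using suppD[of y] by (auto simp: indicator_def)
  have dmD: "integrable lborel (\<lambda>y. (d y - m) * D y)"
  proof (rule Bochner_Integration.integrable_bound)
    show "integrable lborel (\<lambda>y. M * (indicator ?B y * (d y - m)))"
      using dm by (rule integrable_mult_right)
    show "(\<lambda>y. (d y - m) * D y) \<in> borel_measurable lborel"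
      unfolding eqd using borel_measurable_integrable[OF dm] by measurable
    show "AE y in lborel. norm ((d y - m) * D y) \<le> norm (M * (indicator ?B y * (d y - m)))"
    proof (intro AE_I2)
      fix y
      show "norm ((d y - m) * D y) \<le> norm (M * (indicator ?B y * (d y - m)))"
        unfolding eqd using mult_right_mono[OF M[of y], of "\<bar>indicator ?B y * (d y - m)\<bar>"] M0
        by (simp add: abs_mult mult_ac)
    qed
  qed
  have D0: "integrable lborel D" "(\<integral>y. D y \<partial>lborel) = 0"
  proof -
    have "g y = 0" if "norm y > norm x + r" for y
    proof (rule supp)
      show "y \<notin> ball x r" using that norm_triangle_ineq2[of y x] by (auto simp: dist_norm norm_minus_commute)
    qed
    then show "integrable lborel D" "(\<integral>y. D y \<partial>lborel) = 0"
      using integral_partial_eq_0[OF part contg cont] by blast+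
  qed
  have "(\<integral>y. d y * D y \<partial>lborel) = (\<integral>y. (d y - m) * D y + m * D y \<partial>lborel)"
    by (simp add: algebra_simps)
  also have "\<dots> = (\<integral>y. (d y - m) * D y \<partial>lborel)"
    using dmD D0 by simp
  finally have "\<bar>\<integral>y. d y * D y \<partial>lborel\<bar> \<le> (\<integral>y. \<bar>(d y - m) * D y\<bar> \<partial>lborel)"
    using integral_abs_bound[of lborel "\<lambda>y. (d y - m) * D y"] by simp
  also have "\<dots> \<le> (\<integral>y. M * \<bar>indicator ?B y * (d y - m)\<bar> \<partial>lborel)"
  proof (rule integral_mono)
    show "integrable lborel (\<lambda>y. \<bar>(d y - m) * D y\<bar>)" using dmD by simp
    show "integrable lborel (\<lambda>y. M * \<bar>indicator ?B y * (d y - m)\<bar>)" using dm by simp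
    show "\<bar>(d y - m) * D y\<bar> \<le> M * \<bar>indicator ?B y * (d y - m)\<bar>" for y
      unfolding eqd using mult_right_mono[OF M[of y], of "\<bar>indicator ?B y * (d y - m)\<bar>"]
      by (simp add: abs_mult mult_ac)
  qed
  also have "\<dots> = M * (LINT y:?B|lborel. \<bar>d y - m\<bar>)"
    by (simp add: set_lebesgue_integral_def abs_mult)
  also have "\<dots> \<le> M * (K * measure lborel ?B)"
    using osc[OF r, of x] Bpos M0 unfolding m_def[symmetric]
    by (intro mult_left_mono) (simp_all add: avg_def m_def divide_le_eq)
  finally show ?thesis by (simp add: mult_ac)
qed

text \<open>The weak formula moves the derivative onto the rescaled mollifier, which costs a factor
  \<open>1 / \<rho>\<close>. The entries of the potential enter only through mean oscillations,
  whose bound is the same at every scale.\<close>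

lemma BMO_minus1_mollified_bound:
  fixes u :: "real^3 \<Rightarrow> real^3"
  assumes bmo: "BMO_minus1 u" and contu: "\<And>i. continuous_on UNIV (\<lambda>x. u x $ i)"
    and supp: "\<And>z. norm z > 2 \<Longrightarrow> \<eta> z = 0"
    and smooth: "\<And>s v. smooth_fun (\<lambda>y. \<eta> (s *\<^sub>R y + v))"
  obtains K where "K > 0" "\<And>x \<rho> i. \<rho> > 0 \<Longrightarrow> \<bar>\<integral>z. u (x + \<rho> *\<^sub>R z) $ i * \<eta> z \<partial>lborel\<bar> \<le> K / \<rho>"
proof -
  obtain d :: "3 \<Rightarrow> 3 \<Rightarrow> real^3 \<Rightarrow> real" where
    dB: "\<And>i j. BMO (d i j)" and
    weak: "\<And>i \<phi>. test_fun \<phi> \<Longrightarrow> (\<integral>x. u x $ i * \<phi> x \<partial>lborel) =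
             - (\<Sum>j\<in>UNIV. \<integral>x. d i j x * partial j \<phi> x \<partial>lborel)"
    using bmo unfolding BMO_minus1_def by blast
  have dint: "\<And>i j x r. r > 0 \<Longrightarrow> set_integrable lborel (ball x r) (d i j)"
    using dB unfolding BMO_def by blast
  have "\<exists>C. \<forall>x r. r > 0 \<longrightarrow> avg (\<lambda>y. \<bar>d i j y - avg (d i j) (ball x r)\<bar>) (ball x r) \<le> C" for i j
    using dB[of i j] unfolding BMO_def by blast
  then obtain C where C: "\<And>i j x r. r > 0 \<Longrightarrow>
      avg (\<lambda>y. \<bar>d i j y - avg (d i j) (ball x r)\<bar>) (ball x r) \<le> C i j"
    by metis
  \<comment> \<open>The sum serves as one oscillation bound for all nine entries.\<close>
  define K0 where "K0 = (\<Sum>i\<in>UNIV. \<Sum>j\<in>UNIV. \<bar>C i j\<bar>)"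
  have CK: "C i j \<le> K0" for i j
  proof -
    have "\<bar>C i j\<bar> \<le> (\<Sum>j\<in>UNIV. \<bar>C i j\<bar>)" by (rule member_le_sum) auto
    also have "\<dots> \<le> K0" unfolding K0_def
      by (rule member_le_sum[where f = "\<lambda>i. \<Sum>j\<in>UNIV. \<bar>C i j\<bar>"]) (auto intro: sum_nonneg)
    finally show ?thesis by linarith
  qed
  have osc: "avg (\<lambda>y. \<bar>d i j y - avg (d i j) (ball x r)\<bar>) (ball x r) \<le> K0" if "r > 0" for i j x r
    using C[OF that] CK order_trans by blast
  have K0: "K0 \<ge> 0" unfolding K0_def by (intro sum_nonneg) auto
  have sm: "smooth_fun \<eta>" using smooth[of 1 0] by simp
  have part: "has_partial j \<eta> (partial j \<eta>)" for j using sm by (rule smooth_fun_has_partial)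
  have conte: "continuous_on UNIV \<eta>" "continuous_on UNIV (partial j \<eta>)" for j
    using sm by (auto intro: smooth_fun_continuous smooth_fun_partial)
  have suppD: "norm z > 2 \<Longrightarrow> partial j \<eta> z = 0" for z j
    using has_partial_vanishes[OF part supp] by blast
  have "\<exists>M>0. \<forall>x. \<bar>partial j \<eta> x\<bar> \<le> M" for j
    using continuous_compact_support_bounded[OF conte(2) suppD] by metis
  then obtain M where M: "\<And>j. M j > 0" "\<And>j x. \<bar>partial j \<eta> x\<bar> \<le> M j" by metis
  let ?v = "measure lborel (ball (0::real^3) 1)"
  \<comment> \<open>The factor 27 comes from the volume of a ball of radius
    \<open>3 * \<rho>\<close>; the added 1 secures \<open>K > 0\<close>.\<close>
  define K where "K = (\<Sum>j\<in>UNIV. M j) * K0 * 27 * ?v + 1"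
  have "K > 0" unfolding K_def using M(1) K0
    by (intro add_nonneg_pos mult_nonneg_nonneg sum_nonneg) (auto intro: less_imp_le)
  moreover have "\<bar>\<integral>z. u (x + \<rho> *\<^sub>R z) $ i * \<eta> z \<partial>lborel\<bar> \<le> K / \<rho>" if \<rho>: "\<rho> > 0" for x \<rho> i
  proof -
    \<comment> \<open>This is the mollifier recentred at \<open>x\<close> and stretched by
      \<open>\<rho>\<close>, written as an affine substitution so that the smoothness assumption
      applies. The Jacobian \<open>\<rho> ^ 3\<close> of the change of variables cancels against the
      volume at the end.\<close>
    define \<psi> where "\<psi> = (\<lambda>y. \<eta> ((1 / \<rho>) *\<^sub>R y + (- (1 / \<rho>) *\<^sub>R x)))"
    define D where "D j = (\<lambda>y. (1 / \<rho>) * partial j \<eta> ((1 / \<rho>) *\<^sub>R y + (- (1 / \<rho>) *\<^sub>R x)))" for j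
    have arg: "(1 / \<rho>) *\<^sub>R y + (- (1 / \<rho>) *\<^sub>R x) = (1 / \<rho>) *\<^sub>R (y - x)" for y
      by (simp add: algebra_simps)
    have \<psi>\<eta>: "\<psi> (x + \<rho> *\<^sub>R z) = \<eta> z" for z
      unfolding \<psi>_def arg using \<rho> by simp
    \<comment> \<open>The mollifier vanishes beyond radius 2, so the ball of radius
      \<open>3 * \<rho>\<close> leaves room for a strict inequality.\<close>
    have far: "norm ((1 / \<rho>) *\<^sub>R (y - x)) > 2" if "y \<notin> ball x (3 * \<rho>)" for y
      using that \<rho> by (auto simp: dist_norm norm_minus_commute less_divide_eq)
    have p\<psi>: "has_partial j \<psi> (D j)" for j
      unfolding \<psi>_def D_def by (rule has_partial_affine[OF part])
    have c\<psi>: "continuous_on UNIV \<psi>"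
      unfolding \<psi>_def by (intro continuous_on_compose2[OF conte(1)] continuous_intros) auto
    have cD: "continuous_on UNIV (D j)" for j
      unfolding D_def by (intro continuous_intros continuous_on_compose2[OF conte(2)]) auto
    have s\<psi>: "\<psi> y = 0" if "y \<notin> ball x (3 * \<rho>)" for y
      unfolding \<psi>_def arg by (intro supp far that)
    have sD: "D j y = 0" if "y \<notin> ball x (3 * \<rho>)" for j y
      unfolding D_def arg using suppD[OF far[OF that]] by simp
    have bD: "\<bar>D j y\<bar> \<le> M j / \<rho>" for j y
      unfolding D_def using M(2)[of j] \<rho> by (simp add: abs_mult divide_right_mono)
    have tf: "test_fun \<psi>"
      unfolding test_fun_def
    proof
      show "smooth_fun \<psi>" unfolding \<psi>_def by (rule smooth)
      have "{y. \<psi> y \<noteq> 0} \<subseteq> ball x (3 * \<rho>)" using s\<psi> by blast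
      then show "compact (closure {y. \<psi> y \<noteq> 0})"
        using bounded_subset[OF bounded_ball] compact_closure by blast
    qed
    have meas: "(\<lambda>y. u y $ i * \<psi> y) \<in> borel_measurable borel"
      by (intro borel_measurable_continuous_onI continuous_intros contu c\<psi>)
    have vol: "measure lborel (ball x (3 * \<rho>)) = 27 * \<rho> ^ 3 * ?v"
      using content_ball_conv_unit_ball[of "3 * \<rho>" x] \<rho> by (simp add: power_mult_distrib)
    have "\<rho> ^ 3 * (\<integral>z. u (x + \<rho> *\<^sub>R z) $ i * \<eta> z \<partial>lborel)
        = \<rho> ^ 3 * (\<integral>z. u (x + \<rho> *\<^sub>R z) $ i * \<psi> (x + \<rho> *\<^sub>R z) \<partial>lborel)"
      by (simp add: \<psi>\<eta>)
    also have "\<dots> = (\<integral>y. u y $ i * \<psi> y \<partial>lborel)"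
      using lborel_integral_affine[OF meas \<rho>, of x] by simp
    also have "\<dots> = - (\<Sum>j\<in>UNIV. \<integral>y. d i j y * D j y \<partial>lborel)"
      using weak[OF tf] by (simp add: partial_eqI[OF p\<psi>])
    finally have eq: "\<rho> ^ 3 * (\<integral>z. u (x + \<rho> *\<^sub>R z) $ i * \<eta> z \<partial>lborel)
        = - (\<Sum>j\<in>UNIV. \<integral>y. d i j y * D j y \<partial>lborel)" .
    have "\<rho> ^ 3 * \<bar>\<integral>z. u (x + \<rho> *\<^sub>R z) $ i * \<eta> z \<partial>lborel\<bar>
        = \<bar>\<rho> ^ 3 * (\<integral>z. u (x + \<rho> *\<^sub>R z) $ i * \<eta> z \<partial>lborel)\<bar>"
      using \<rho> by (simp add: abs_mult)
    also have "\<dots> = \<bar>\<Sum>j\<in>UNIV. \<integral>y. d i j y * D j y \<partial>lborel\<bar>"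
      unfolding eq by simp
    also have "\<dots> \<le> (\<Sum>j\<in>UNIV. \<bar>\<integral>y. d i j y * D j y \<partial>lborel\<bar>)" by (rule sum_abs)
    also have "\<dots> \<le> (\<Sum>j\<in>UNIV. M j / \<rho> * K0 * (27 * \<rho> ^ 3 * ?v))"
      unfolding vol[symmetric]
      using \<rho> by (intro sum_mono BMO_integral_partial_bound[OF dint osc p\<psi> c\<psi> cD s\<psi> _ bD sD]) auto
    also have "\<dots> = \<rho> ^ 3 * ((\<Sum>j\<in>UNIV. M j) * K0 * 27 * ?v / \<rho>)"
      by (simp add: sum_divide_distrib sum_distrib_left sum_distrib_right mult_ac)
    also have "\<dots> \<le> \<rho> ^ 3 * (K / \<rho>)"
      using \<rho> by (intro mult_left_mono divide_right_mono) (auto simp: K_def)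
    finally show ?thesis by (rule mult_left_le_imp_le) (use \<rho> in simp)
  qed
  ultimately show ?thesis by (rule that)
qed

section \<open>Integrability of the fourth power\<close>

definition grad :: "(real^3 \<Rightarrow> real) \<Rightarrow> real^3 \<Rightarrow> real^3" where
  "grad g x = (\<chi> j. partial j g x)"

lemma grad_inner: "(\<Sum>j\<in>UNIV. partial j g x * h $ j) = grad g x \<bullet> h"
  by (simp add: grad_def inner_vec_def)

lemma continuous_on_grad: "smooth_fun g \<Longrightarrow> continuous_on UNIV (grad g)"
  unfolding grad_def
  by (intro continuous_on_vec_lambda smooth_fun_continuous smooth_fun_partial)

text \<open>The fundamental theorem of calculus along the segment is followed by Cauchy-Schwarz. The
  extended nonnegative form lets later averages be exchanged by Tonelli without integrability
  conditions.\<close>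

lemma increment_le_integral_grad:
  assumes v: "smooth_fun v"
  shows "ennreal \<bar>v (x + h) - v x\<bar> \<le>
    (\<integral>\<^sup>+s. ennreal (norm h * norm (grad v (x + s *\<^sub>R h))) * indicator {0..1} s \<partial>lborel)"
proof -
  let ?g = "\<lambda>s. grad v (x + s *\<^sub>R h) \<bullet> h"
  have cont: "continuous_on UNIV ?g"
    by (intro continuous_intros continuous_on_compose2[OF continuous_on_grad[OF v]]) auto
  have der: "((\<lambda>t. v (x + t *\<^sub>R h)) has_real_derivative ?g t) (at t)" for t
    using smooth_fun_along_line[OF v, of x h t UNIV] by (simp add: grad_inner)
  have int: "integrable lborel (\<lambda>s. ?g s * indicator {0..1} s)"
    by (intro borel_integrable_atLeastAtMost) (use cont in \<open>auto simp: continuous_on_eq_continuous_at\<close>)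
  have "(\<integral>s. ?g s * indicator {0..1} s \<partial>lborel) = v (x + h) - v x"
    using integral_FTC_Icc_real[of 0 1 "\<lambda>t. v (x + t *\<^sub>R h)" ?g] der cont
    by (simp add: continuous_on_eq_continuous_at)
  then have "ennreal \<bar>v (x + h) - v x\<bar> \<le> (\<integral>\<^sup>+s. ennreal (norm (?g s * indicator {0..1} s)) \<partial>lborel)"
    using integral_norm_bound_ennreal[OF int] by simp
  also have "\<dots> \<le> (\<integral>\<^sup>+s. ennreal (norm h * norm (grad v (x + s *\<^sub>R h))) * indicator {0..1} s \<partial>lborel)"
  proof (rule nn_integral_mono)
    fix s
    show "ennreal (norm (?g s * indicator {0..1} s))
        \<le> ennreal (norm h * norm (grad v (x + s *\<^sub>R h))) * indicator {0..1} s"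
      using Cauchy_Schwarz_ineq2[of "grad v (x + s *\<^sub>R h)" h]
      by (auto simp: indicator_def abs_mult mult.commute intro!: ennreal_leI)
  qed
  finally show ?thesis .
qed

lemma nn_integral_lborel_translate:
  fixes h :: "'a::euclidean_space \<Rightarrow> ennreal"
  assumes [measurable]: "h \<in> borel_measurable borel"
  shows "(\<integral>\<^sup>+x. h (x + a) \<partial>lborel) = (\<integral>\<^sup>+x. h x \<partial>lborel)"
proof -
  have eq: "lborel = distr lborel borel (\<lambda>x. a + x)" by (simp add: lborel_distr_plus)
  show ?thesis by (subst (2) eq, subst nn_integral_distr) (auto simp: add.commute)
qed

text \<open>Choosing the mollification radius inversely proportional to the level makes the mollified
  function at most half the level; on the level set, the remainder is then carried by the points
  where the gradient exceeds a multiple of the squared level.\<close>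

lemma mollified_weak_type:
  fixes v \<eta> :: "real^3 \<Rightarrow> real"
  assumes v: "smooth_fun v"
    and \<eta>0: "\<And>z. 0 \<le> \<eta> z" and \<eta>s: "\<And>z. norm z > 2 \<Longrightarrow> \<eta> z = 0"
    and \<eta>1: "(\<integral>z. \<eta> z \<partial>lborel) = 1" and \<eta>c: "continuous_on UNIV \<eta>"
    and K: "K > 0" and bound: "\<And>x \<rho>. \<rho> > 0 \<Longrightarrow> \<bar>\<integral>z. v (x + \<rho> *\<^sub>R z) * \<eta> z \<partial>lborel\<bar> \<le> K / \<rho>"
    and l: "l > 0"
  shows "ennreal (l / 4) * emeasure lborel {x. l \<le> \<bar>v x\<bar>} \<le>
    ennreal (4 * K / l) * (\<integral>\<^sup>+x. ennreal (norm (grad v x)) * indicator {x. l\<^sup>2 / (16 * K) \<le> norm (grad v x)} x \<partial>lborel)"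
proof -
  \<comment> \<open>With these choices the mollified value is at most
    \<open>K / \<rho> = l / 2\<close>, while gradients below \<open>\<mu>\<close> change
    \<open>v\<close> by at most \<open>2 * \<rho> * \<mu> = l / 4\<close> over the support of the
    mollifier. A quarter of the level \<open>l\<close> is left for the large gradients.\<close>
  define \<rho> where "\<rho> = 2 * K / l"
  define \<mu> where "\<mu> = l\<^sup>2 / (16 * K)"
  have \<rho>: "\<rho> > 0" and \<mu>: "\<mu> > 0" using K l by (auto simp: \<rho>_def \<mu>_def)
  have \<rho>\<mu>: "2 * \<rho> * \<mu> = l / 4" using K l by (simp add: \<rho>_def \<mu>_def power2_eq_square)
  have K\<rho>: "K / \<rho> = l / 2" using K l by (simp add: \<rho>_def)
  define F where "F = (\<lambda>x. ennreal (norm (grad v x)) * indicator {x. \<mu> \<le> norm (grad v x)} x)"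
  have cv: "continuous_on UNIV v" using v by (rule smooth_fun_continuous)
  have cg: "continuous_on UNIV (\<lambda>x. norm (grad v x))"
    by (intro continuous_intros continuous_on_grad v)
  have [measurable]: "(\<lambda>x. norm (grad v x)) \<in> borel_measurable borel" "v \<in> borel_measurable borel"
     "\<eta> \<in> borel_measurable borel"
    using cg cv \<eta>c by (auto intro: borel_measurable_continuous_onI)
  have [measurable]: "F \<in> borel_measurable borel" unfolding F_def by measurable
  have fF: "ennreal (norm (grad v y)) \<le> ennreal \<mu> + F y" for y
    by (auto simp: F_def indicator_def intro: ennreal_leI order_trans[OF ennreal_leI])
  have int\<eta>: "integrable lborel \<eta>" using \<eta>c \<eta>s by (rule integrable_continuous_compact_support)
  have \<eta>nn: "(\<integral>\<^sup>+z. ennreal (\<eta> z) \<partial>lborel) = 1"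
    using nn_integral_eq_integral[OF int\<eta>] \<eta>0 \<eta>1 by simp
  \<comment> \<open>\<open>A\<close> is a weighted average of translates of \<open>F\<close> with
    total weight one, so it has the same integral as \<open>F\<close>.\<close>
  define A where "A = (\<lambda>x. \<integral>\<^sup>+z. ennreal (\<eta> z) * (\<integral>\<^sup>+s. F (x + s *\<^sub>R (\<rho> *\<^sub>R z)) * indicator {0..1::real} s \<partial>lborel) \<partial>lborel)"
  have incr: "ennreal \<bar>v (x + \<rho> *\<^sub>R z) - v x\<bar> * ennreal (\<eta> z) \<le>
      ennreal (l / 4) * ennreal (\<eta> z) +
      ennreal (2 * \<rho>) * (ennreal (\<eta> z) * (\<integral>\<^sup>+s. F (x + s *\<^sub>R (\<rho> *\<^sub>R z)) * indicator {0..1} s \<partial>lborel))" for x z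
  proof (cases "norm z \<le> 2")
    case False
    then show ?thesis using \<eta>s[of z] by simp
  next
    case True
    have "ennreal \<bar>v (x + \<rho> *\<^sub>R z) - v x\<bar> \<le>
        (\<integral>\<^sup>+s. ennreal (norm (\<rho> *\<^sub>R z) * norm (grad v (x + s *\<^sub>R (\<rho> *\<^sub>R z)))) * indicator {0..1} s \<partial>lborel)"
      by (rule increment_le_integral_grad[OF v])
    also have "\<dots> \<le> (\<integral>\<^sup>+s. ennreal (2 * \<rho>) * ((ennreal \<mu> + F (x + s *\<^sub>R (\<rho> *\<^sub>R z))) * indicator {0..1} s) \<partial>lborel)"
    proof (rule nn_integral_mono)
      fix s :: real
      have "ennreal (norm (\<rho> *\<^sub>R z) * norm (grad v (x + s *\<^sub>R (\<rho> *\<^sub>R z))))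
          \<le> ennreal (2 * \<rho>) * ennreal (norm (grad v (x + s *\<^sub>R (\<rho> *\<^sub>R z))))"
        using True \<rho> by (subst ennreal_mult[symmetric]) (auto intro!: ennreal_leI mult_right_mono simp: mult.commute)
      also have "\<dots> \<le> ennreal (2 * \<rho>) * (ennreal \<mu> + F (x + s *\<^sub>R (\<rho> *\<^sub>R z)))"
        by (intro mult_left_mono fF) auto
      finally show "ennreal (norm (\<rho> *\<^sub>R z) * norm (grad v (x + s *\<^sub>R (\<rho> *\<^sub>R z)))) * indicator {0..1} s
          \<le> ennreal (2 * \<rho>) * ((ennreal \<mu> + F (x + s *\<^sub>R (\<rho> *\<^sub>R z))) * indicator {0..1} s)"
        by (auto simp: indicator_def)
    qed
    also have "\<dots> = ennreal (2 * \<rho>) * (ennreal \<mu> + (\<integral>\<^sup>+s. F (x + s *\<^sub>R (\<rho> *\<^sub>R z)) * indicator {0..1} s \<partial>lborel))"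
      by (simp add: nn_integral_cmult distrib_right nn_integral_add nn_integral_cmult_indicator)
    also have "\<dots> = ennreal (l / 4) + ennreal (2 * \<rho>) * (\<integral>\<^sup>+s. F (x + s *\<^sub>R (\<rho> *\<^sub>R z)) * indicator {0..1} s \<partial>lborel)"
      unfolding \<rho>\<mu>[symmetric] using \<rho> \<mu> by (simp add: distrib_left ennreal_mult)
    finally have "ennreal \<bar>v (x + \<rho> *\<^sub>R z) - v x\<bar> * ennreal (\<eta> z) \<le>
        (ennreal (l / 4) + ennreal (2 * \<rho>) * (\<integral>\<^sup>+s. F (x + s *\<^sub>R (\<rho> *\<^sub>R z)) * indicator {0..1} s \<partial>lborel)) * ennreal (\<eta> z)"
      by (rule mult_right_mono) simp
    also have "\<dots> = ennreal (l / 4) * ennreal (\<eta> z) + ennreal (2 * \<rho>) *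
        (ennreal (\<eta> z) * (\<integral>\<^sup>+s. F (x + s *\<^sub>R (\<rho> *\<^sub>R z)) * indicator {0..1} s \<partial>lborel))"
      by (simp add: distrib_left distrib_right mult_ac)
    finally show ?thesis .
  qed
  have point: "ennreal (l / 4) * indicator {x. l \<le> \<bar>v x\<bar>} x \<le> ennreal (2 * \<rho>) * A x" for x
  proof (cases "l \<le> \<bar>v x\<bar>")
    case True
    have cvz: "continuous_on UNIV (\<lambda>z. v (x + \<rho> *\<^sub>R z) * \<eta> z)"
      by (intro continuous_intros continuous_on_compose2[OF cv] \<eta>c) auto
    have i1: "integrable lborel (\<lambda>z. v (x + \<rho> *\<^sub>R z) * \<eta> z)"
      using \<eta>s by (intro integrable_continuous_compact_support[OF cvz, of 2]) auto
    have i2: "integrable lborel (\<lambda>z. (v (x + \<rho> *\<^sub>R z) - v x) * \<eta> z)"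
      using i1 int\<eta> by (simp add: left_diff_distrib)
    have "(\<integral>z. (v (x + \<rho> *\<^sub>R z) - v x) * \<eta> z \<partial>lborel) = (\<integral>z. v (x + \<rho> *\<^sub>R z) * \<eta> z \<partial>lborel) - v x"
      using i1 int\<eta> \<eta>1 by (simp add: left_diff_distrib)
    then have "l / 2 \<le> \<bar>\<integral>z. (v (x + \<rho> *\<^sub>R z) - v x) * \<eta> z \<partial>lborel\<bar>"
      using bound[OF \<rho>, of x] True unfolding K\<rho> by linarith
    then have "ennreal (l / 2) \<le> ennreal \<bar>\<integral>z. (v (x + \<rho> *\<^sub>R z) - v x) * \<eta> z \<partial>lborel\<bar>"
      by (rule ennreal_leI)
    also have "\<dots> \<le> (\<integral>\<^sup>+z. ennreal (norm ((v (x + \<rho> *\<^sub>R z) - v x) * \<eta> z)) \<partial>lborel)"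
      using integral_norm_bound_ennreal[OF i2] by simp
    also have "\<dots> = (\<integral>\<^sup>+z. ennreal \<bar>v (x + \<rho> *\<^sub>R z) - v x\<bar> * ennreal (\<eta> z) \<partial>lborel)"
      using \<eta>0 by (simp add: abs_mult ennreal_mult)
    also have "\<dots> \<le> (\<integral>\<^sup>+z. ennreal (l / 4) * ennreal (\<eta> z) +
      ennreal (2 * \<rho>) * (ennreal (\<eta> z) * (\<integral>\<^sup>+s. F (x + s *\<^sub>R (\<rho> *\<^sub>R z)) * indicator {0..1} s \<partial>lborel)) \<partial>lborel)"
      by (intro nn_integral_mono incr)
    also have "\<dots> = ennreal (l / 4) + ennreal (2 * \<rho>) * A x"
      by (simp add: nn_integral_add nn_integral_cmult \<eta>nn A_def)
    \<comment> \<open>Writing \<open>l / 2\<close> as two quarters allows the finite term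
      \<open>l / 4\<close> to be cancelled in the extended reals.\<close>
    finally have "ennreal (l / 4) + ennreal (l / 4) \<le> ennreal (l / 4) + ennreal (2 * \<rho>) * A x"
      using l by (simp flip: ennreal_plus)
    then show ?thesis using True by (simp add: ennreal_add_left_cancel_le)
  qed simp
  have AF: "(\<integral>\<^sup>+x. A x \<partial>lborel) = (\<integral>\<^sup>+x. F x \<partial>lborel)"
  proof -
    have inner: "(\<integral>\<^sup>+x. \<integral>\<^sup>+s. F (x + s *\<^sub>R (\<rho> *\<^sub>R z)) * indicator {0..1::real} s \<partial>lborel \<partial>lborel) = (\<integral>\<^sup>+x. F x \<partial>lborel)" for z
    proof -
      have "(\<integral>\<^sup>+x. \<integral>\<^sup>+s. F (x + s *\<^sub>R (\<rho> *\<^sub>R z)) * indicator {0..1::real} s \<partial>lborel \<partial>lborel)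
        = (\<integral>\<^sup>+s. \<integral>\<^sup>+x. F (x + s *\<^sub>R (\<rho> *\<^sub>R z)) * indicator {0..1::real} s \<partial>lborel \<partial>lborel)"
        by (rule lborel_pair.Fubini') measurable
      also have "\<dots> = (\<integral>\<^sup>+s. (\<integral>\<^sup>+x. F x \<partial>lborel) * indicator {0..1::real} s \<partial>lborel)"
        by (simp add: nn_integral_multc nn_integral_lborel_translate)
      also have "\<dots> = (\<integral>\<^sup>+x. F x \<partial>lborel)" by (simp add: nn_integral_cmult)
      finally show ?thesis .
    qed
    have "(\<integral>\<^sup>+x. A x \<partial>lborel) = (\<integral>\<^sup>+z. \<integral>\<^sup>+x. ennreal (\<eta> z) * (\<integral>\<^sup>+s. F (x + s *\<^sub>R (\<rho> *\<^sub>R z)) * indicator {0..1::real} s \<partial>lborel) \<partial>lborel \<partial>lborel)"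
      unfolding A_def by (rule lborel_pair.Fubini') measurable
    also have "\<dots> = (\<integral>\<^sup>+z. ennreal (\<eta> z) * (\<integral>\<^sup>+x. \<integral>\<^sup>+s. F (x + s *\<^sub>R (\<rho> *\<^sub>R z)) * indicator {0..1::real} s \<partial>lborel \<partial>lborel) \<partial>lborel)"
      by (intro nn_integral_cong nn_integral_cmult) measurable
    also have "\<dots> = (\<integral>\<^sup>+z. ennreal (\<eta> z) * (\<integral>\<^sup>+x. F x \<partial>lborel) \<partial>lborel)"
      by (simp only: inner)
    also have "\<dots> = (\<integral>\<^sup>+x. F x \<partial>lborel)" by (simp add: nn_integral_multc \<eta>nn)
    finally show ?thesis .
  qed
  have "ennreal (l / 4) * emeasure lborel {x. l \<le> \<bar>v x\<bar>} = (\<integral>\<^sup>+x. ennreal (l / 4) * indicator {x. l \<le> \<bar>v x\<bar>} x \<partial>lborel)"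
    by (simp add: nn_integral_cmult)
  also have "\<dots> \<le> (\<integral>\<^sup>+x. ennreal (2 * \<rho>) * A x \<partial>lborel)"
    by (intro nn_integral_mono point)
  also have "\<dots> = ennreal (2 * \<rho>) * (\<integral>\<^sup>+x. F x \<partial>lborel)"
    unfolding AF[symmetric] by (rule nn_integral_cmult) (unfold A_def, measurable)
  finally show ?thesis by (simp add: F_def \<rho>_def \<mu>_def)
qed

text \<open>Layer cake: the levels \<open>l\<close> are integrated with weight
  \<open>4 * l ^ 3\<close>, and the weak estimate is inserted at each level. After exchanging the
  integrals, the gradient at \<open>x\<close> is weighted by the integral of
  \<open>64 * K * l\<close> up to \<open>sqrt (16 * K * norm (grad v x))\<close>, which is again a
  multiple of the gradient norm; this produces the square.\<close>

lemma mollified_L4: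
  fixes v \<eta> :: "real^3 \<Rightarrow> real"
  assumes v: "smooth_fun v"
    and \<eta>0: "\<And>z. 0 \<le> \<eta> z" and \<eta>s: "\<And>z. norm z > 2 \<Longrightarrow> \<eta> z = 0"
    and \<eta>1: "(\<integral>z. \<eta> z \<partial>lborel) = 1" and \<eta>c: "continuous_on UNIV \<eta>"
    and K: "K > 0" and bound: "\<And>x \<rho>. \<rho> > 0 \<Longrightarrow> \<bar>\<integral>z. v (x + \<rho> *\<^sub>R z) * \<eta> z \<partial>lborel\<bar> \<le> K / \<rho>"
  shows "(\<integral>\<^sup>+x. ennreal (v x ^ 4) \<partial>lborel) \<le> ennreal (512 * K\<^sup>2) * (\<integral>\<^sup>+x. ennreal ((norm (grad v x))\<^sup>2) \<partial>lborel)"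
proof -
  let ?f = "\<lambda>x. norm (grad v x)"
  have cv: "continuous_on UNIV v" using v by (rule smooth_fun_continuous)
  have cg: "continuous_on UNIV ?f"
    by (intro continuous_intros continuous_on_grad v)
  have [measurable]: "?f \<in> borel_measurable borel" "v \<in> borel_measurable borel"
    using cg cv by (auto intro: borel_measurable_continuous_onI)
  have layer: "ennreal (v x ^ 4) = (\<integral>\<^sup>+l. ennreal (4 * l ^ 3) * indicator {0..\<bar>v x\<bar>} l \<partial>lborel)" for x
    using nn_integral_FTC_Icc[of "\<lambda>l::real. 4 * l ^ 3" 0 "\<bar>v x\<bar>" "\<lambda>l. l ^ 4"]
    by (force intro!: derivative_eq_intros simp: power_even_abs)
  have layer2: "(\<integral>\<^sup>+l. ennreal (64 * K * l) * indicator {0..sqrt (16 * K * ?f x)} l \<partial>lborel) = ennreal (512 * K\<^sup>2 * ?f x)" for x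
  proof -
    have "(\<integral>\<^sup>+l. ennreal (64 * K * l) * indicator {0..sqrt (16 * K * ?f x)} l \<partial>lborel)
        = ennreal (32 * K * (sqrt (16 * K * ?f x))\<^sup>2 - 32 * K * 0\<^sup>2)"
      using K by (intro nn_integral_FTC_Icc) (auto intro!: derivative_eq_intros)
    then show ?thesis using K by (simp add: power2_eq_square mult_ac)
  qed
  have level: "ennreal (4 * l ^ 3) * indicator {0..} l * emeasure lborel {x. l \<le> \<bar>v x\<bar>} \<le>
      ennreal (64 * K * l) * indicator {0..} l * (\<integral>\<^sup>+x. ennreal (?f x) * indicator {x. l\<^sup>2 / (16 * K) \<le> ?f x} x \<partial>lborel)"
    (is "_ \<le> _ * ?I l") for l
  proof (cases "l > 0")
    case True
    \<comment> \<open>The weak estimate is multiplied by \<open>16 * l\<^sup>2\<close>, which turns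
      \<open>l / 4\<close> into \<open>4 * l ^ 3\<close> and \<open>4 * K / l\<close> into
      \<open>64 * K * l\<close>.\<close>
    have "ennreal (4 * l ^ 3) * emeasure lborel {x. l \<le> \<bar>v x\<bar>} =
        ennreal (16 * l\<^sup>2) * (ennreal (l / 4) * emeasure lborel {x. l \<le> \<bar>v x\<bar>})"
      using True by (simp add: mult.assoc[symmetric] ennreal_mult[symmetric] power2_eq_square power3_eq_cube)
    also have "\<dots> \<le> ennreal (16 * l\<^sup>2) * (ennreal (4 * K / l) * ?I l)"
      by (intro mult_left_mono mollified_weak_type[OF v \<eta>0 \<eta>s \<eta>1 \<eta>c K bound True]) auto
    also have "\<dots> = ennreal (64 * K * l) * ?I l"
    proof -
      have "ennreal (16 * l\<^sup>2) * ennreal (4 * K / l) = ennreal (64 * K * l)"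
        using True K by (simp add: ennreal_mult[symmetric] power2_eq_square mult_ac)
      then show ?thesis by (simp add: mult.assoc[symmetric])
    qed
    finally show ?thesis using True by simp
  next
    case False
    then show ?thesis by (cases "l = 0") auto
  qed
  have "(\<integral>\<^sup>+x. ennreal (v x ^ 4) \<partial>lborel)
      = (\<integral>\<^sup>+l. \<integral>\<^sup>+x. ennreal (4 * l ^ 3) * indicator {0..\<bar>v x\<bar>} l \<partial>lborel \<partial>lborel)"
    \<comment> \<open>Joint measurability of the indicator of a moving interval is seen after
      rewriting membership as two inequalities.\<close>
    unfolding layer by (rule lborel_pair.Fubini') (measurable, unfold atLeastAtMost_iff, measurable)
  also have "\<dots> = (\<integral>\<^sup>+l. ennreal (4 * l ^ 3) * indicator {0..} l * emeasure lborel {x. l \<le> \<bar>v x\<bar>} \<partial>lborel)"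
  proof (rule nn_integral_cong)
    fix l :: real
    have "(\<integral>\<^sup>+x. ennreal (4 * l ^ 3) * indicator {0..\<bar>v x\<bar>} l \<partial>lborel)
        = (\<integral>\<^sup>+x. ennreal (4 * l ^ 3) * indicator {0..} l * indicator {x. l \<le> \<bar>v x\<bar>} x \<partial>lborel)"
      by (intro nn_integral_cong) (auto simp: indicator_def)
    then show "(\<integral>\<^sup>+x. ennreal (4 * l ^ 3) * indicator {0..\<bar>v x\<bar>} l \<partial>lborel)
        = ennreal (4 * l ^ 3) * indicator {0..} l * emeasure lborel {x. l \<le> \<bar>v x\<bar>}"
      by (simp add: nn_integral_cmult)
  qed
  also have "\<dots> \<le> (\<integral>\<^sup>+l. ennreal (64 * K * l) * indicator {0..} l *
      (\<integral>\<^sup>+x. ennreal (?f x) * indicator {x. l\<^sup>2 / (16 * K) \<le> ?f x} x \<partial>lborel) \<partial>lborel)"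
    by (intro nn_integral_mono level)
  also have "\<dots> = (\<integral>\<^sup>+l. \<integral>\<^sup>+x. ennreal (?f x) * (ennreal (64 * K * l) * indicator {0..sqrt (16 * K * ?f x)} l) \<partial>lborel \<partial>lborel)"
  proof (rule nn_integral_cong)
    fix l :: real
    have iff: "(l\<^sup>2 / (16 * K) \<le> ?f x) = (l \<le> sqrt (16 * K * ?f x))" if "0 \<le> l" for x
    proof -
      have "(l\<^sup>2 / (16 * K) \<le> ?f x) = (l\<^sup>2 \<le> 16 * K * ?f x)"
        using K by (simp add: divide_le_eq mult_ac)
      also have "\<dots> = (l \<le> sqrt (16 * K * ?f x))"
        using that real_le_rsqrt[of l] real_sqrt_le_iff[of "l\<^sup>2"] by (metis real_sqrt_abs abs_of_nonneg)
      finally show ?thesis .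
    qed
    have "ennreal (64 * K * l) * indicator {0..} l * (\<integral>\<^sup>+x. ennreal (?f x) * indicator {x. l\<^sup>2 / (16 * K) \<le> ?f x} x \<partial>lborel)
      = (\<integral>\<^sup>+x. ennreal (64 * K * l) * indicator {0..} l * (ennreal (?f x) * indicator {x. l\<^sup>2 / (16 * K) \<le> ?f x} x) \<partial>lborel)"
      by (rule nn_integral_cmult[symmetric]) measurable
    also have "\<dots> = (\<integral>\<^sup>+x. ennreal (?f x) * (ennreal (64 * K * l) * indicator {0..sqrt (16 * K * ?f x)} l) \<partial>lborel)"
    proof (rule nn_integral_cong)
      fix x
      show "ennreal (64 * K * l) * indicator {0..} l * (ennreal (?f x) * indicator {x. l\<^sup>2 / (16 * K) \<le> ?f x} x)
          = ennreal (?f x) * (ennreal (64 * K * l) * indicator {0..sqrt (16 * K * ?f x)} l)"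
        using iff[of x] by (cases "0 \<le> l") (simp_all add: indicator_def mult.commute[of _ "ennreal (?f x)"])
    qed
    finally show "ennreal (64 * K * l) * indicator {0..} l * (\<integral>\<^sup>+x. ennreal (?f x) * indicator {x. l\<^sup>2 / (16 * K) \<le> ?f x} x \<partial>lborel)
       = (\<integral>\<^sup>+x. ennreal (?f x) * (ennreal (64 * K * l) * indicator {0..sqrt (16 * K * ?f x)} l) \<partial>lborel)" .
  qed
  also have "\<dots> = (\<integral>\<^sup>+x. \<integral>\<^sup>+l. ennreal (?f x) * (ennreal (64 * K * l) * indicator {0..sqrt (16 * K * ?f x)} l) \<partial>lborel \<partial>lborel)"
    by (rule lborel_pair.Fubini') (measurable, unfold atLeastAtMost_iff, measurable)
  also have "\<dots> = (\<integral>\<^sup>+x. ennreal (512 * K\<^sup>2) * ennreal ((?f x)\<^sup>2) \<partial>lborel)"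
  proof (rule nn_integral_cong)
    fix x
    have "(\<integral>\<^sup>+l. ennreal (?f x) * (ennreal (64 * K * l) * indicator {0..sqrt (16 * K * ?f x)} l) \<partial>lborel)
        = ennreal (?f x) * ennreal (512 * K\<^sup>2 * ?f x)"
      unfolding layer2[symmetric] by (rule nn_integral_cmult) measurable
    then show "(\<integral>\<^sup>+l. ennreal (?f x) * (ennreal (64 * K * l) * indicator {0..sqrt (16 * K * ?f x)} l) \<partial>lborel)
        = ennreal (512 * K\<^sup>2) * ennreal ((?f x)\<^sup>2)"
      using K by (simp add: ennreal_mult[symmetric] power2_eq_square mult_ac)
  qed
  also have "\<dots> = ennreal (512 * K\<^sup>2) * (\<integral>\<^sup>+x. ennreal ((?f x)\<^sup>2) \<partial>lborel)"
    by (rule nn_integral_cmult) measurable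
  finally show ?thesis .
qed

section \<open>Skew potentials and cutoff functions\<close>

definition ray_mean :: "nat \<Rightarrow> (real^3 \<Rightarrow> real) \<Rightarrow> real^3 \<Rightarrow> real" where
  "ray_mean k w x = integral {0..1} (\<lambda>t. t ^ k * w (t *\<^sub>R x))"

lemma continuous_on_ray:
  fixes w :: "real^3 \<Rightarrow> real"
  assumes "continuous_on UNIV w"
  shows "continuous_on S (\<lambda>t. t ^ k * w (t *\<^sub>R x))"
proof -
  have "continuous_on S (\<lambda>t. t *\<^sub>R x)" by (intro continuous_intros)
  from continuous_on_compose2[OF assms this] show ?thesis
    by (intro continuous_intros) auto
qed

lemma continuous_ray_mean:
  assumes w: "continuous_on UNIV w"
  shows "continuous_on UNIV (ray_mean k w)"
proof -
  have "continuous_on (UNIV \<times> cbox 0 1) (\<lambda>(x, t). t ^ k * w (t *\<^sub>R x))"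
    unfolding case_prod_beta by (intro continuous_intros continuous_on_compose2[OF w]) auto
  from integral_continuous_on_param[OF this] show ?thesis
    by (simp add: ray_mean_def[abs_def] cbox_interval)
qed

text \<open>Differentiation under the integral sign: the inner dilation contributes a factor
  \<open>t\<close>, which raises the exponent of the weight by one.\<close>

lemma has_partial_ray_mean:
  assumes part: "has_partial j w W" and w: "continuous_on UNIV w" and W: "continuous_on UNIV W"
  shows "has_partial j (ray_mean k w) (ray_mean (Suc k) W)"
proof (rule has_partialI)
  fix x
  let ?e = "axis j 1 :: real^3"
  have d: "((\<lambda>s. t ^ k * w (t *\<^sub>R (x + s *\<^sub>R ?e))) has_real_derivative t ^ Suc k * W (t *\<^sub>R (x + s *\<^sub>R ?e))) (at s)"
    for s t
  proof -
    have "((\<lambda>s. w (t *\<^sub>R x + (t * s) *\<^sub>R ?e)) has_real_derivative W (t *\<^sub>R x + (t * s) *\<^sub>R ?e) * t) (at s)"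
      by (rule DERIV_chain2[where f = "\<lambda>r. w (t *\<^sub>R x + r *\<^sub>R ?e)" and g = "\<lambda>s. t * s", OF has_partial_along[OF part] DERIV_cmult_Id])
    from DERIV_cmult[OF this, of "t ^ k"] show ?thesis
      by (simp add: algebra_simps)
  qed
  have c: "continuous_on (UNIV \<times> cbox 0 1) (\<lambda>(s, t). t ^ Suc k * W (t *\<^sub>R (x + s *\<^sub>R ?e)))"
    unfolding case_prod_beta by (intro continuous_intros continuous_on_compose2[OF W]) auto
  have i: "(\<lambda>t. t ^ k * w (t *\<^sub>R (x + s *\<^sub>R ?e))) integrable_on cbox 0 1" for s
    by (intro integrable_continuous continuous_on_ray w)
  show "((\<lambda>s. ray_mean k w (x + s *\<^sub>R ?e)) has_real_derivative ray_mean (Suc k) W x) (at 0)"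
    using leibniz_rule_field_derivative[of UNIV 0 1 "\<lambda>s t. t ^ k * w (t *\<^sub>R (x + s *\<^sub>R ?e))"
        "\<lambda>s t. t ^ Suc k * W (t *\<^sub>R (x + s *\<^sub>R ?e))" 0, OF d i c]
    by (simp add: ray_mean_def cbox_interval)
qed

text \<open>Expansion of the nonnegative variance of \<open>g\<close> over the unit interval, whose
  length is one.\<close>

lemma square_integral_le:
  fixes g :: "real \<Rightarrow> real"
  assumes g: "continuous_on {0..1} g"
  shows "(integral {0..1} g)\<^sup>2 \<le> integral {0..1} (\<lambda>t. (g t)\<^sup>2)"
proof -
  let ?m = "integral {0..1} g"
  have "0 \<le> integral {0..1} (\<lambda>t. (g t - ?m)\<^sup>2)"
    by (rule integral_nonneg) (auto intro!: integrable_continuous_interval continuous_intros g)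
  also have "\<dots> = integral {0..1} (\<lambda>t. (g t)\<^sup>2 - (2 * ?m * g t - ?m\<^sup>2))"
    by (simp add: power2_eq_square algebra_simps)
  also have "\<dots> = integral {0..1} (\<lambda>t. (g t)\<^sup>2) - (2 * ?m * ?m - ?m\<^sup>2)"
  proof -
    have "integral {0..1} (\<lambda>t. 2 * ?m * g t - ?m\<^sup>2) = 2 * ?m * ?m - ?m\<^sup>2"
      by (subst Henstock_Kurzweil_Integration.integral_diff)
        (auto intro!: integrable_continuous_interval continuous_intros g)
    then show ?thesis
      by (subst Henstock_Kurzweil_Integration.integral_diff)
        (auto intro!: integrable_continuous_interval continuous_intros g)
  qed
  finally show ?thesis by (simp add: power2_eq_square)
qed

lemma ray_mean_power2:
  assumes "continuous_on UNIV w"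
  shows "(ray_mean k w x)\<^sup>2 \<le> ray_mean (2 * k) (\<lambda>y. (w y)\<^sup>2) x"
  using square_integral_le[OF continuous_on_ray[OF assms], of k x]
  by (simp add: ray_mean_def power_mult_distrib power_mult[symmetric] mult.commute)

text \<open>Squaring twice turns the weight \<open>t\<close> into \<open>t ^ 4\<close>. The square
  of \<open>ray_mean 2\<close>, which occurs for gradients, leads to the same exponent.\<close>

lemma ray_mean_power4:
  assumes "continuous_on UNIV w"
  shows "(ray_mean 1 w x) ^ 4 \<le> ray_mean 4 (\<lambda>y. (w y) ^ 4) x"
proof -
  have "(ray_mean 1 w x) ^ 4 = ((ray_mean 1 w x)\<^sup>2)\<^sup>2" by simp
  also have "\<dots> \<le> (ray_mean 2 (\<lambda>y. (w y)\<^sup>2) x)\<^sup>2"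
    using ray_mean_power2[OF assms, of 1 x] by (intro power_mono) auto
  also have "\<dots> \<le> ray_mean 4 (\<lambda>y. ((w y)\<^sup>2)\<^sup>2) x"
    using ray_mean_power2[of "\<lambda>y. (w y)\<^sup>2" 2 x] assms by (simp add: continuous_intros)
  finally show ?thesis by simp
qed

lemma lborel_nn_integral_affine:
  fixes h :: "'a::euclidean_space \<Rightarrow> ennreal"
  assumes [measurable]: "h \<in> borel_measurable borel" and "c > 0"
  shows "(\<integral>\<^sup>+y. h y \<partial>lborel) = ennreal (c ^ DIM('a)) * (\<integral>\<^sup>+z. h (t + c *\<^sub>R z) \<partial>lborel)"
  using \<open>c > 0\<close>
  by (subst lborel_affine[of c t]) (simp_all add: nn_integral_density nn_integral_distr nn_integral_cmult)

text \<open>The weight \<open>t ^ 4\<close> beats the Jacobian \<open>t ^ 3\<close> of the dilation by \<open>t\<close>.\<close>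

lemma nn_integral_ray_mean_le:
  assumes w: "continuous_on UNIV w" and w0: "\<And>x. 0 \<le> w x"
  shows "(\<integral>\<^sup>+x. ennreal (ray_mean 4 w x) \<partial>lborel) \<le> (\<integral>\<^sup>+x. ennreal (w x) \<partial>lborel)"
proof -
  have [measurable]: "w \<in> borel_measurable borel" using w by (rule borel_measurable_continuous_onI)
  have eq: "ennreal (ray_mean 4 w x) = (\<integral>\<^sup>+t. ennreal (t ^ 4 * w (t *\<^sub>R x)) * indicator {0..1} t \<partial>lborel)" for x
  proof -
    have "((\<lambda>t. t ^ 4 * w (t *\<^sub>R x)) has_integral ray_mean 4 w x) {0..1}"
      unfolding ray_mean_def by (intro integrable_integral integrable_continuous_interval continuous_on_ray w)
    from nn_integral_has_integral_lebesgue[OF _ this] w0 have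
      "(\<integral>\<^sup>+t. ennreal (indicat_real {0..1} t * (t ^ 4 * w (t *\<^sub>R x))) \<partial>lborel) = ennreal (ray_mean 4 w x)"
      by (simp add: nn_integral_completion)
    moreover have "ennreal (t ^ 4 * w (t *\<^sub>R x)) * indicator {0..1} t
        = ennreal (indicat_real {0..1} t * (t ^ 4 * w (t *\<^sub>R x)))" for t
      by (simp add: indicator_def)
    ultimately show ?thesis by simp
  qed
  have "(\<integral>\<^sup>+x. ennreal (ray_mean 4 w x) \<partial>lborel)
      = (\<integral>\<^sup>+t. \<integral>\<^sup>+x. ennreal (t ^ 4 * w (t *\<^sub>R x)) * indicator {0..1::real} t \<partial>lborel \<partial>lborel)"
    unfolding eq by (rule lborel_pair.Fubini') measurable
  also have "\<dots> \<le> (\<integral>\<^sup>+t. (\<integral>\<^sup>+x. ennreal (w x) \<partial>lborel) * indicator {0..1::real} t \<partial>lborel)"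
  proof (rule nn_integral_mono)
    fix t :: real
    show "(\<integral>\<^sup>+x. ennreal (t ^ 4 * w (t *\<^sub>R x)) * indicator {0..1::real} t \<partial>lborel)
        \<le> (\<integral>\<^sup>+x. ennreal (w x) \<partial>lborel) * indicator {0..1::real} t"
    proof (cases "0 < t \<and> t \<le> 1")
      case True
      have "(\<integral>\<^sup>+x. ennreal (t ^ 4 * w (t *\<^sub>R x)) * indicator {0..1::real} t \<partial>lborel)
          = (\<integral>\<^sup>+x. ennreal (t ^ 4) * ennreal (w (t *\<^sub>R x)) \<partial>lborel)"
        using True w0 by (simp add: ennreal_mult)
      also have "\<dots> = ennreal (t ^ 4) * (\<integral>\<^sup>+x. ennreal (w (t *\<^sub>R x)) \<partial>lborel)"
        by (rule nn_integral_cmult) measurable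
      also have "\<dots> \<le> ennreal (t ^ 3) * (\<integral>\<^sup>+x. ennreal (w (t *\<^sub>R x)) \<partial>lborel)"
        using True by (intro mult_right_mono ennreal_leI power_decreasing) auto
      also have "\<dots> = (\<integral>\<^sup>+x. ennreal (w x) \<partial>lborel)"
        using True lborel_nn_integral_affine[of "\<lambda>x. ennreal (w x)" t 0] by simp
      finally show ?thesis using True by simp
    next
      case False
      \<comment> \<open>At \<open>t = 0\<close> the dilation is degenerate, but the weight
        \<open>t ^ 4\<close> vanishes; the other excluded values lie outside the unit
        interval.\<close>
      then show ?thesis by (cases "t = 0") (auto simp: indicator_def)
    qed
  qed
  also have "\<dots> = (\<integral>\<^sup>+x. ennreal (w x) \<partial>lborel)" by (simp add: nn_integral_cmult)
  finally show ?thesis .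
qed

section \<open>A skew potential for a divergence-free field\<close>

text \<open>The Poincare homotopy operator, applied to the closed two-form dual to a divergence-free field.\<close>

definition skew_potential :: "(3 \<Rightarrow> real^3 \<Rightarrow> real) \<Rightarrow> 3 \<Rightarrow> 3 \<Rightarrow> real^3 \<Rightarrow> real" where
  "skew_potential v i j x = x $ j * ray_mean 1 (v i) x - x $ i * ray_mean 1 (v j) x"

text \<open>The first index \<open>k\<close> is the direction of differentiation; the other two
  select the entry.\<close>

definition skew_potential_partial :: "(3 \<Rightarrow> real^3 \<Rightarrow> real) \<Rightarrow> 3 \<Rightarrow> 3 \<Rightarrow> 3 \<Rightarrow> real^3 \<Rightarrow> real" where
  "skew_potential_partial v k i j x =
     ((if j = k then 1 else 0) * ray_mean 1 (v i) x + x $ j * ray_mean 2 (partial k (v i)) x)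
   - ((if i = k then 1 else 0) * ray_mean 1 (v j) x + x $ i * ray_mean 2 (partial k (v j)) x)"

lemma skew_potential_skew: "skew_potential v i j x = - skew_potential v j i x"
  by (simp add: skew_potential_def)

lemma has_partial_ray_mean_smooth:
  "smooth_fun w \<Longrightarrow> has_partial k (ray_mean 1 w) (ray_mean 2 (partial k w))"
  using has_partial_ray_mean[of k w "partial k w" 1]
  by (simp add: smooth_fun_has_partial smooth_fun_continuous smooth_fun_partial numeral_2_eq_2)

lemma has_partial_skew_potential:
  assumes "\<And>i. smooth_fun (v i)"
  shows "has_partial k (skew_potential v i j) (skew_potential_partial v k i j)"
  unfolding skew_potential_def[abs_def] skew_potential_partial_def[abs_def]
  by (intro has_partial_diff has_partial_mult has_partial_coord has_partial_ray_mean_smooth assms)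

lemma continuous_skew_potential:
  assumes "\<And>i. smooth_fun (v i)"
  shows "continuous_on UNIV (skew_potential v i j)" "continuous_on UNIV (skew_potential_partial v k i j)"
  unfolding skew_potential_def[abs_def] skew_potential_partial_def[abs_def]
  by (intro continuous_intros continuous_ray_mean smooth_fun_continuous smooth_fun_partial assms)+

text \<open>The Kronecker terms give three copies of the ray mean of \<open>v i\<close> minus one,
  and the divergence condition removes the terms with the factor \<open>x $ i\<close>. The remainder
  is the integral over the unit interval of the derivative of
  \<open>t\<^sup>2 * v i (t *\<^sub>R x)\<close>, which is \<open>v i x\<close>.\<close>

lemma div_skew_potential:
  assumes v: "\<And>i. smooth_fun (v i)" and div: "\<And>x. (\<Sum>j\<in>UNIV. partial j (v j) x) = 0"
  shows "(\<Sum>j\<in>UNIV. skew_potential_partial v j i j x) = v i x"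
proof -
  have int: "(\<lambda>t. t ^ k * w (t *\<^sub>R x)) integrable_on {0..1}" if "continuous_on UNIV w" for w k
    by (intro integrable_continuous_interval continuous_on_ray that)
  have cv: "continuous_on UNIV (v i)" "continuous_on UNIV (partial k (v i))" for i k
    using v by (auto intro: smooth_fun_continuous smooth_fun_partial)
  have "(\<Sum>j\<in>UNIV. ray_mean 2 (partial j (v j)) x) = integral {0..1} (\<lambda>t. \<Sum>j\<in>UNIV. t\<^sup>2 * partial j (v j) (t *\<^sub>R x))"
    unfolding ray_mean_def by (intro Henstock_Kurzweil_Integration.integral_sum[symmetric] int cv) auto
  also have "\<dots> = 0" using div by (simp flip: sum_distrib_left)
  finally have d0: "(\<Sum>j\<in>UNIV. ray_mean 2 (partial j (v j)) x) = 0" .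
  have f1: "((\<lambda>t. 2 * (t ^ 1 * v i (t *\<^sub>R x)) + (\<Sum>j\<in>UNIV. x $ j * (t\<^sup>2 * partial j (v i) (t *\<^sub>R x))))
      has_integral 1\<^sup>2 * v i (1 *\<^sub>R x) - 0\<^sup>2 * v i (0 *\<^sub>R x)) {0..1}"
  proof (rule fundamental_theorem_of_calculus)
    fix t :: real
    have "((\<lambda>t. v i (t *\<^sub>R x)) has_real_derivative (\<Sum>j\<in>UNIV. partial j (v i) (t *\<^sub>R x) * x $ j)) (at t within {0..1})"
      using smooth_fun_along_line[OF v[of i], of 0 x t "{0..1}"] by simp
    moreover have "((\<lambda>t. t\<^sup>2) has_real_derivative 2 * t) (at t within {0..1})"
      by (auto intro!: derivative_eq_intros)
    ultimately have "((\<lambda>t. t\<^sup>2 * v i (t *\<^sub>R x)) has_real_derivative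
        2 * t * v i (t *\<^sub>R x) + (\<Sum>j\<in>UNIV. partial j (v i) (t *\<^sub>R x) * x $ j) * t\<^sup>2) (at t within {0..1})"
      by (rule DERIV_mult[rotated])
    then
    have "((\<lambda>t. t\<^sup>2 * v i (t *\<^sub>R x)) has_real_derivative
        2 * (t ^ 1 * v i (t *\<^sub>R x)) + (\<Sum>j\<in>UNIV. x $ j * (t\<^sup>2 * partial j (v i) (t *\<^sub>R x)))) (at t within {0..1})"
      by (simp add: sum_distrib_left mult_ac)
    then show "((\<lambda>t. t\<^sup>2 * v i (t *\<^sub>R x)) has_vector_derivative
        2 * (t ^ 1 * v i (t *\<^sub>R x)) + (\<Sum>j\<in>UNIV. x $ j * (t\<^sup>2 * partial j (v i) (t *\<^sub>R x)))) (at t within {0..1})"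
      by (simp add: has_real_derivative_iff_has_vector_derivative)
  qed simp
  have f2: "((\<lambda>t. 2 * (t ^ 1 * v i (t *\<^sub>R x)) + (\<Sum>j\<in>UNIV. x $ j * (t\<^sup>2 * partial j (v i) (t *\<^sub>R x))))
      has_integral 2 * ray_mean 1 (v i) x + (\<Sum>j\<in>UNIV. x $ j * ray_mean 2 (partial j (v i)) x)) {0..1}"
    unfolding ray_mean_def
    by (intro has_integral_add has_integral_mult_right has_integral_sum integrable_integral int cv) auto
  have "2 * ray_mean 1 (v i) x + (\<Sum>j\<in>UNIV. x $ j * ray_mean 2 (partial j (v i)) x) = v i x"
    using has_integral_unique[OF f2 f1] by simp
  moreover have "(\<Sum>j\<in>UNIV. skew_potential_partial v j i j x)
      = 2 * ray_mean 1 (v i) x + (\<Sum>j\<in>UNIV. x $ j * ray_mean 2 (partial j (v i)) x)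
        - x $ i * (\<Sum>j\<in>UNIV. ray_mean 2 (partial j (v j)) x)"
    using exhaust_3[of i] by (auto simp: skew_potential_partial_def sum_3 algebra_simps)
  ultimately show ?thesis using d0 by simp
qed

section \<open>Radial cutoff functions with two continuous derivatives\<close>

lemma DERIV_max_power:
  "((\<lambda>y::real. (max 0 y) ^ Suc (Suc n)) has_real_derivative real (Suc (Suc n)) * (max 0 y) ^ Suc n) (at y)"
proof -
  consider "y < 0" | "y = 0" | "y > 0" by linarith
  then show ?thesis
  proof cases
    case 1
    then have "\<forall>\<^sub>F s in nhds y. (max 0 s) ^ Suc (Suc n) = 0"
      using eventually_nhds_in_open[of "{..<0}" y] by (auto elim!: eventually_mono)
    then have "((\<lambda>y::real. (max 0 y) ^ Suc (Suc n)) has_real_derivative 0) (at y)"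
      by (subst DERIV_cong_ev[of y y _ "\<lambda>t. 0" 0 0]) auto
    then show ?thesis using 1 by simp
  next
    case 2
    have "((\<lambda>h::real. max 0 h ^ Suc n) \<longlongrightarrow> max 0 0 ^ Suc n) (at 0)"
      by (intro tendsto_intros)
    then have l: "((\<lambda>h::real. max 0 h ^ Suc n) \<longlongrightarrow> 0) (at 0)" by simp
    have "((\<lambda>h::real. ((max 0 (0 + h)) ^ Suc (Suc n) - (max 0 0) ^ Suc (Suc n)) / h) \<longlongrightarrow> 0) (at 0)"
    proof (rule Lim_transform_eventually[OF l])
      show "\<forall>\<^sub>F h in at (0::real). max 0 h ^ Suc n = ((max 0 (0 + h)) ^ Suc (Suc n) - (max 0 0) ^ Suc (Suc n)) / h"
        by (auto simp: eventually_at_filter max_def)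
    qed
    then show ?thesis using 2 by (simp add: DERIV_def)
  next
    case 3
    have "((\<lambda>y::real. y ^ Suc (Suc n)) has_real_derivative real (Suc (Suc n)) * y ^ Suc n) (at y)"
      by (rule DERIV_cong[OF DERIV_pow]) simp
    moreover have "\<forall>\<^sub>F s in nhds y. (max 0 s) ^ Suc (Suc n) = s ^ Suc (Suc n)"
      using eventually_nhds_in_open[of "{0<..}" y] 3 by (auto elim!: eventually_mono)
    ultimately show ?thesis using 3 by (subst DERIV_cong_ev[OF refl _ refl]) auto
  qed
qed

text \<open>Truncated cubes are twice continuously differentiable, so nesting two of them gives an
  explicit profile. Two derivatives suffice because the test field contains one derivative of the
  cutoff and is differentiated once more.\<close>

lemma cutoff_exists:
  obtains s s1 s2 :: "real \<Rightarrow> real" where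
    "\<And>t. (s has_real_derivative s1 t) (at t)" "\<And>t. (s1 has_real_derivative s2 t) (at t)"
    "continuous_on UNIV s2" "\<And>t. t \<le> 1 \<Longrightarrow> s t = 1" "\<And>t. t \<ge> 2 \<Longrightarrow> s t = 0" "\<And>t. 0 \<le> s t"
    "\<And>t. t \<le> 1 \<or> t \<ge> 2 \<Longrightarrow> s1 t = 0" "\<And>t. t \<le> 1 \<or> t \<ge> 2 \<Longrightarrow> s2 t = 0"
proof -
  define m :: "real \<Rightarrow> real" where "m = max 0"
  define s where "s = (\<lambda>t. m (1 - m (t - 1) ^ 3) ^ 3)"
  define s1 where "s1 = (\<lambda>t. - (9 * m (1 - m (t - 1) ^ 3) ^ 2 * m (t - 1) ^ 2))"
  define s2 where "s2 = (\<lambda>t. 54 * m (1 - m (t - 1) ^ 3) * (m (t - 1) ^ 2) ^ 2 - 18 * m (1 - m (t - 1) ^ 3) ^ 2 * m (t - 1))"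
  have d3: "((\<lambda>y. m y ^ 3) has_real_derivative 3 * m y ^ 2) (at y)" for y
    using DERIV_max_power[of 1 y] by (simp add: m_def numeral_3_eq_3 numeral_2_eq_2)
  have d2: "((\<lambda>y. m y ^ 2) has_real_derivative 2 * m y) (at y)" for y
    using DERIV_max_power[of 0 y] by (simp add: m_def numeral_2_eq_2)
  have shift: "((\<lambda>t. t - 1) has_real_derivative 1) (at t)" for t :: real
    by (auto intro!: derivative_eq_intros)
  have inner: "((\<lambda>t. 1 - m (t - 1) ^ 3) has_real_derivative - (3 * m (t - 1) ^ 2)) (at t)" for t
    using DERIV_diff[OF DERIV_const[of 1] DERIV_chain2[OF d3 shift], of t] by simp
  have inner2: "((\<lambda>t. m (t - 1) ^ 2) has_real_derivative 2 * m (t - 1)) (at t)" for t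
    using DERIV_chain2[OF d2 shift, of t] by simp
  show ?thesis
  proof (rule that[of s s1 s2])
    show "(s has_real_derivative s1 t) (at t)" for t
      using DERIV_chain2[OF d3 inner, of t] by (simp add: s_def s1_def mult_ac)
    show "(s1 has_real_derivative s2 t) (at t)" for t
      using DERIV_minus[OF DERIV_cmult[OF DERIV_mult[OF DERIV_chain2[OF d2 inner] inner2], of 9, of t]]
      by (simp add: s1_def s2_def algebra_simps power2_eq_square)
    show "continuous_on UNIV s2" unfolding s2_def m_def by (intro continuous_intros)
    show "0 \<le> s t" for t by (simp add: s_def m_def)
    show "s t = 1" if "t \<le> 1" for t using that by (simp add: s_def m_def)
    have big: "m (1 - m (t - 1) ^ 3) = 0" if "t \<ge> 2" for t
    proof -
      have "1 \<le> m (t - 1) ^ 3" using that by (intro one_le_power) (auto simp: m_def)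
      then show ?thesis by (simp add: m_def)
    qed
    show "s t = 0" if "t \<ge> 2" for t using big[OF that] by (simp add: s_def)
    show "s1 t = 0" "s2 t = 0" if "t \<le> 1 \<or> t \<ge> 2" for t
      using that big[of t] by (auto simp: s1_def s2_def m_def)
  qed
qed

text \<open>\<open>P j\<close> is a first derivative and \<open>Q k j\<close> a second one with
  direction \<open>k\<close> applied last. The powers of \<open>R\<close> are those of dilating one
  fixed profile, and \<open>c\<close> is meant to be chosen before \<open>R\<close>.\<close>

definition radial_cutoff ::
  "real \<Rightarrow> real \<Rightarrow> (real^3 \<Rightarrow> real) \<Rightarrow> (3 \<Rightarrow> real^3 \<Rightarrow> real) \<Rightarrow> (3 \<Rightarrow> 3 \<Rightarrow> real^3 \<Rightarrow> real) \<Rightarrow> bool" where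
  "radial_cutoff c R \<phi> P Q \<longleftrightarrow>
      (\<forall>j. has_partial j \<phi> (P j)) \<and> (\<forall>j k. has_partial k (P j) (Q k j)) \<and>
      continuous_on UNIV \<phi> \<and> (\<forall>j. continuous_on UNIV (P j)) \<and> (\<forall>j k. continuous_on UNIV (Q k j)) \<and>
      (\<forall>x. 0 \<le> \<phi> x) \<and> (\<forall>x. norm x \<le> R \<longrightarrow> \<phi> x = 1) \<and> (\<forall>x. norm x > 2 * R \<longrightarrow> \<phi> x = 0) \<and>
      (\<forall>x j. norm x < R \<or> norm x > 2 * R \<longrightarrow> P j x = 0) \<and>
      (\<forall>x j k. norm x < R \<or> norm x > 2 * R \<longrightarrow> Q k j x = 0) \<and>
      (\<forall>x j. \<bar>P j x\<bar> \<le> c / R) \<and> (\<forall>x j k. \<bar>Q k j x\<bar> \<le> c / R\<^sup>2)"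

text \<open>The profile is composed with the squared norm over \<open>R\<^sup>2\<close>, a
  polynomial, so no singularity at the origin has to be treated.\<close>

lemma radial_cutoff_exists:
  obtains c :: real where "c > 0" "\<And>R. R \<ge> 1 \<Longrightarrow> \<exists>\<phi> P Q. radial_cutoff c R \<phi> P Q"
proof -
  obtain s s1 s2 :: "real \<Rightarrow> real" where
    ds: "\<And>t. (s has_real_derivative s1 t) (at t)" "\<And>t. (s1 has_real_derivative s2 t) (at t)" and
    cs2: "continuous_on UNIV s2" and one: "\<And>t. t \<le> 1 \<Longrightarrow> s t = 1" and
    zero: "\<And>t. t \<ge> 2 \<Longrightarrow> s t = 0" and nn: "\<And>t. 0 \<le> s t" and
    s10: "\<And>t. t \<le> 1 \<or> t \<ge> 2 \<Longrightarrow> s1 t = 0" and s20: "\<And>t. t \<le> 1 \<or> t \<ge> 2 \<Longrightarrow> s2 t = 0"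
    by (rule cutoff_exists) (rule that; assumption)
  have cs: "continuous_on UNIV s" "continuous_on UNIV s1"
    using ds by (auto intro!: continuous_at_imp_continuous_on DERIV_isCont)
  have "norm t > 2 \<Longrightarrow> t \<le> 1 \<or> t \<ge> 2" for t :: real by auto
  then have "norm t > 2 \<Longrightarrow> s1 t = 0" "norm t > 2 \<Longrightarrow> s2 t = 0" for t using s10 s20 by blast+
  then obtain M1 M2 where M: "M1 > 0" "\<And>t. \<bar>s1 t\<bar> \<le> M1" "M2 > 0" "\<And>t. \<bar>s2 t\<bar> \<le> M2"
    using continuous_compact_support_bounded[OF cs(2)] continuous_compact_support_bounded[OF cs2] by metis
  \<comment> \<open>\<open>16 * M2\<close> comes from two factors
    \<open>(2 / R\<^sup>2) * (2 * R)\<close> in the second derivative, \<open>4 * M1\<close> from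
    one such factor in the first. The remaining term \<open>2 * M1 / R\<^sup>2\<close> of the second
    derivative is covered as well.\<close>
  define c where "c = 16 * M2 + 4 * M1"
  have "c > 0" using M by (simp add: c_def)
  moreover have "\<exists>\<phi> P Q. radial_cutoff c R \<phi> P Q" if R: "R \<ge> 1" for R
  proof -
    define q :: "real^3 \<Rightarrow> real" where "q = (\<lambda>x. (1 / R\<^sup>2) * (x \<bullet> x))"
    define \<phi> where "\<phi> = (\<lambda>x. s (q x))"
    define P where "P = (\<lambda>j x. s1 (q x) * ((2 / R\<^sup>2) * x $ j))"
    define Q where "Q = (\<lambda>k j x. (s2 (q x) * ((2 / R\<^sup>2) * x $ k)) * ((2 / R\<^sup>2) * x $ j)
        + s1 (q x) * ((2 / R\<^sup>2) * (if j = k then 1 else 0)))"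
    have scale: "has_partial j (\<lambda>x. a * f x) (\<lambda>x. a * F x)" if "has_partial j f F" for j a f F
      using has_partial_mult[OF has_partial_const[of j a] that] by simp
    have dq: "has_partial j q (\<lambda>x. (2 / R\<^sup>2) * x $ j)" for j
      using scale[OF has_partial_inner[of j], of "1 / R\<^sup>2"] by (simp add: q_def)
    have cq: "continuous_on UNIV q" unfolding q_def by (intro continuous_intros)
    have qn: "q x = (norm x / R)\<^sup>2" for x by (simp add: q_def power_divide power2_norm_eq_inner)
    have q1: "q x \<le> 1" if "norm x \<le> R" for x
      using that R unfolding qn by (intro power_le_one) auto
    have q2: "q x \<ge> 2" if "norm x > 2 * R" for x
    proof -
      have "2\<^sup>2 \<le> (norm x / R)\<^sup>2" using that R by (intro power_mono) (auto simp: le_divide_eq)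
      then show ?thesis by (simp add: qn)
    qed
    have xj: "\<bar>x $ j\<bar> \<le> 2 * R" if "\<not> (norm x < R \<or> norm x > 2 * R)" for x :: "real^3" and j
      using that component_le_norm_cart[of x j] by linarith
    have P0: "P j x = 0" if "norm x < R \<or> norm x > 2 * R" for j x
      using that q1[of x] q2[of x] s10[of "q x"] by (auto simp: P_def)
    have Q0: "Q k j x = 0" if "norm x < R \<or> norm x > 2 * R" for j k x
      using that q1[of x] q2[of x] s10[of "q x"] s20[of "q x"] by (auto simp: Q_def)
    have Rp: "R > 0" using R by simp
    have PB: "\<bar>P j x\<bar> \<le> c / R" for j x
    proof (cases "norm x < R \<or> norm x > 2 * R")
      case False
      have "\<bar>P j x\<bar> = \<bar>s1 (q x)\<bar> * ((2 / R\<^sup>2) * \<bar>x $ j\<bar>)" using Rp by (simp add: P_def abs_mult)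
      also have "\<dots> \<le> M1 * ((2 / R\<^sup>2) * (2 * R))"
        using M Rp xj[OF False] by (intro mult_mono) auto
      also have "\<dots> = (4 * M1) / R" using Rp by (simp add: power2_eq_square)
      also have "\<dots> \<le> c / R" using Rp M by (intro divide_right_mono) (auto simp: c_def)
      finally show ?thesis .
    qed (use P0 Rp \<open>c > 0\<close> in auto)
    have QB: "\<bar>Q k j x\<bar> \<le> c / R\<^sup>2" for k j x
    proof (cases "norm x < R \<or> norm x > 2 * R")
      case False
      have "\<bar>Q k j x\<bar> \<le> \<bar>(s2 (q x) * ((2 / R\<^sup>2) * x $ k)) * ((2 / R\<^sup>2) * x $ j)\<bar>
          + \<bar>s1 (q x) * ((2 / R\<^sup>2) * (if j = k then 1 else 0))\<bar>"
        unfolding Q_def by (rule abs_triangle_ineq)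
      also have "\<dots> \<le> (M2 * ((2 / R\<^sup>2) * (2 * R))) * ((2 / R\<^sup>2) * (2 * R)) + M1 * ((2 / R\<^sup>2) * 1)"
        unfolding abs_mult using M Rp xj[OF False] by (intro add_mono mult_mono) auto
      also have "\<dots> = (16 * M2 + 2 * M1) / R\<^sup>2" using Rp by (simp add: power2_eq_square field_simps)
      also have "\<dots> \<le> c / R\<^sup>2" using Rp M by (intro divide_right_mono) (auto simp: c_def)
      finally show ?thesis .
    qed (use Q0 Rp \<open>c > 0\<close> in auto)
    have "has_partial j \<phi> (P j)" for j
      unfolding \<phi>_def P_def by (rule has_partial_chain[OF ds(1) dq])
    moreover have "has_partial k (P j) (Q k j)" for j k
      unfolding P_def Q_def
      by (intro has_partial_mult has_partial_chain[OF ds(2) dq] scale has_partial_coord)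
    moreover have "continuous_on UNIV \<phi>" "continuous_on UNIV (P j)" "continuous_on UNIV (Q k j)" for j k
      unfolding \<phi>_def P_def Q_def
      by (intro continuous_intros continuous_on_compose2[OF cs(1) cq] continuous_on_compose2[OF cs(2) cq]
          continuous_on_compose2[OF cs2 cq]; simp)+
    moreover have "0 \<le> \<phi> x" "norm x \<le> R \<Longrightarrow> \<phi> x = 1" "norm x > 2 * R \<Longrightarrow> \<phi> x = 0" for x
      using nn one q1 zero q2 by (auto simp: \<phi>_def)
    ultimately show ?thesis using P0 Q0 PB QB unfolding radial_cutoff_def
      by (intro exI[of _ \<phi>] exI[of _ P] exI[of _ Q]) auto
  qed
  ultimately show ?thesis by (rule that)
qed

section \<open>The energy identity\<close>

text \<open>Pointwise algebra, with the derivatives at one point treated as free numbers: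
  \<open>w i j\<close> stands for the derivative of \<open>v i\<close> in direction
  \<open>j\<close>, \<open>L i j\<close> for the second one in that direction, \<open>p\<close> and
  \<open>pp\<close> for gradient and Hessian of the pressure, \<open>a\<close> for the cutoff and
  \<open>P\<close> for its gradient. The left side is a divergence; the right side is the localized
  energy plus errors that carry a derivative of the cutoff.\<close>

lemma energy_identity_algebra:
  fixes v p P G :: "3 \<Rightarrow> real" and w L D pp dD dG :: "3 \<Rightarrow> 3 \<Rightarrow> real" and a :: real
  assumes NS: "\<And>i. (\<Sum>j\<in>UNIV. v j * w i j) - (\<Sum>j\<in>UNIV. L i j) = p i"
    and dv: "(\<Sum>j\<in>UNIV. w j j) = 0"
    and skew: "\<And>i j. D i j = - D j i" and sym: "\<And>i j. pp i j = pp j i"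
    and pot: "\<And>i. (\<Sum>j\<in>UNIV. dD i j) = v i"
    and G: "\<And>i. G i = (\<Sum>k\<in>UNIV. P k * D i k)"
  shows "(\<Sum>j\<in>UNIV.
      (\<Sum>i\<in>UNIV. ((P j * v i + a * w i j) + dG i j) * w i j + (a * v i + G i) * L i j)
      + (\<Sum>i\<in>UNIV. pp i j * (a * D i j) + p i * (P j * D i j + a * dD i j))
      - ((P j * v j + a * w j j) * (\<Sum>i\<in>UNIV. v i * v i)
          + a * v j * (\<Sum>i\<in>UNIV. w i j * v i + v i * w i j)) / 2)
    = a * (\<Sum>i\<in>UNIV. \<Sum>j\<in>UNIV. (w i j)\<^sup>2)
      + ((\<Sum>i\<in>UNIV. \<Sum>j\<in>UNIV. P j * v i * w i j) + (\<Sum>i\<in>UNIV. \<Sum>j\<in>UNIV. dG i j * w i j)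
      + (\<Sum>i\<in>UNIV. \<Sum>j\<in>UNIV. G i * v j * w i j)
      - (\<Sum>j\<in>UNIV. P j * v j) * (\<Sum>i\<in>UNIV. v i * v i) / 2)"
proof -
  have L: "(\<Sum>j\<in>UNIV. L i j) = (\<Sum>j\<in>UNIV. v j * w i j) - p i" for i using NS[of i] by simp
  \<comment> \<open>The equation replaces the Laplacian. The pressure gradient that appears here
    cancels against \<open>t3\<close>.\<close>
  have t2: "(\<Sum>j\<in>UNIV. \<Sum>i\<in>UNIV. (a * v i + G i) * L i j)
      = (\<Sum>i\<in>UNIV. (a * v i + G i) * ((\<Sum>j\<in>UNIV. v j * w i j) - p i))"
    unfolding L[symmetric] by (subst sum.swap) (simp add: sum_distrib_left)
  have "(\<Sum>j\<in>UNIV. P j * D i j + a * dD i j) = G i + a * v i" for i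
    unfolding G pot[symmetric] by (simp add: sum.distrib sum_distrib_left)
  then have t3: "(\<Sum>j\<in>UNIV. \<Sum>i\<in>UNIV. p i * (P j * D i j + a * dD i j)) = (\<Sum>i\<in>UNIV. p i * (G i + a * v i))"
    by (subst sum.swap) (simp flip: sum_distrib_left)
  \<comment> \<open>The symmetric Hessian contracted with the skew \<open>D\<close> equals its own
    negative.\<close>
  have "(\<Sum>j\<in>UNIV. \<Sum>i\<in>UNIV. pp i j * (a * D i j)) = (\<Sum>j\<in>UNIV. \<Sum>i\<in>UNIV. pp j i * (a * - D j i))"
    by (intro sum.cong refl) (metis skew sym)
  also have "\<dots> = - (\<Sum>i\<in>UNIV. \<Sum>j\<in>UNIV. pp j i * (a * D j i))"
    by (subst sum.swap) (simp add: sum_negf)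
  finally have t3': "(\<Sum>j\<in>UNIV. \<Sum>i\<in>UNIV. pp i j * (a * D i j)) = 0" by simp
  have t4: "(\<Sum>j\<in>UNIV. (P j * v j + a * w j j) * (\<Sum>i\<in>UNIV. v i * v i)) =
      (\<Sum>j\<in>UNIV. P j * v j) * (\<Sum>i\<in>UNIV. v i * v i)"
    using dv by (simp add: sum.distrib flip: sum_distrib_left sum_distrib_right)
  have split: "(\<Sum>j\<in>UNIV.
      (\<Sum>i\<in>UNIV. ((P j * v i + a * w i j) + dG i j) * w i j + (a * v i + G i) * L i j)
      + (\<Sum>i\<in>UNIV. pp i j * (a * D i j) + p i * (P j * D i j + a * dD i j))
      - ((P j * v j + a * w j j) * (\<Sum>i\<in>UNIV. v i * v i)
          + a * v j * (\<Sum>i\<in>UNIV. w i j * v i + v i * w i j)) / 2)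
    = (\<Sum>j\<in>UNIV. \<Sum>i\<in>UNIV. ((P j * v i + a * w i j) + dG i j) * w i j)
      + (\<Sum>j\<in>UNIV. \<Sum>i\<in>UNIV. (a * v i + G i) * L i j)
      + ((\<Sum>j\<in>UNIV. \<Sum>i\<in>UNIV. pp i j * (a * D i j)) + (\<Sum>j\<in>UNIV. \<Sum>i\<in>UNIV. p i * (P j * D i j + a * dD i j)))
      - ((\<Sum>j\<in>UNIV. (P j * v j + a * w j j) * (\<Sum>i\<in>UNIV. v i * v i))
          + (\<Sum>j\<in>UNIV. a * v j * (\<Sum>i\<in>UNIV. w i j * v i + v i * w i j))) / 2"
    by (simp only: sum.distrib sum_subtractf sum_divide_distrib[symmetric])
  \<comment> \<open>The convective terms with factor \<open>a\<close> cancel the derivative of half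
    the squared speed; of the convection only the part with \<open>G\<close> survives.\<close>
  show ?thesis
    unfolding split t2 t3 t3' t4 unfolding sum_3 by (simp add: power2_eq_square field_simps)
qed

section \<open>Elementary inequalities of power-mean and Young type\<close>

lemma sum3_square_le: "(\<Sum>i\<in>(UNIV::3 set). f i)\<^sup>2 \<le> 3 * (\<Sum>i\<in>UNIV. (f i :: real)\<^sup>2)"
proof -
  have "0 \<le> (f 1 - f 2)\<^sup>2 + (f 2 - f 3)\<^sup>2 + (f 1 - f 3)\<^sup>2" by simp
  then show ?thesis by (simp add: sum_3 power2_eq_square algebra_simps)
qed

lemma sum3_power4_le: "(\<Sum>i\<in>(UNIV::3 set). f i) ^ 4 \<le> 27 * (\<Sum>i\<in>UNIV. (f i :: real) ^ 4)"
proof -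
  have "(\<Sum>i\<in>UNIV. f i) ^ 4 = ((\<Sum>i\<in>UNIV. f i)\<^sup>2)\<^sup>2" by simp
  also have "\<dots> \<le> (3 * (\<Sum>i\<in>UNIV. (f i)\<^sup>2))\<^sup>2"
    by (intro power_mono sum3_square_le) auto
  also have "\<dots> = 9 * (\<Sum>i\<in>UNIV. (f i)\<^sup>2)\<^sup>2" by (simp add: power_mult_distrib)
  also have "\<dots> \<le> 9 * (3 * (\<Sum>i\<in>UNIV. ((f i)\<^sup>2)\<^sup>2))"
    by (intro mult_left_mono sum3_square_le) auto
  finally show ?thesis by simp
qed

lemma sum33_square_le:
  "(\<Sum>i\<in>(UNIV::3 set). \<Sum>j\<in>(UNIV::3 set). f i j)\<^sup>2 \<le> 9 * (\<Sum>i\<in>UNIV. \<Sum>j\<in>UNIV. (f i j :: real)\<^sup>2)"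
proof -
  have "(\<Sum>i\<in>(UNIV::3 set). \<Sum>j\<in>(UNIV::3 set). f i j)\<^sup>2 \<le> 3 * (\<Sum>i\<in>UNIV. (\<Sum>j\<in>UNIV. f i j)\<^sup>2)"
    by (rule sum3_square_le)
  also have "\<dots> \<le> 3 * (\<Sum>i\<in>UNIV. 3 * (\<Sum>j\<in>UNIV. (f i j)\<^sup>2))"
    by (intro mult_left_mono sum_mono sum3_square_le) auto
  finally show ?thesis by (simp add: sum_distrib_left)
qed

text \<open>Young's inequality with exponents 4, 2 and 4, whose reciprocals sum to one; the
  constants are rounded up to 1.\<close>

lemma mult3_le: "(a::real) * b * c \<le> a ^ 4 + b\<^sup>2 + c ^ 4"
proof -
  have "2 * (a * b * c) \<le> b\<^sup>2 + a\<^sup>2 * c\<^sup>2"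
    using sum_squares_bound[of b "a * c"] by (simp add: power_mult_distrib mult_ac)
  moreover have "2 * (a\<^sup>2 * c\<^sup>2) \<le> a ^ 4 + c ^ 4"
    using sum_squares_bound[of "a\<^sup>2" "c\<^sup>2"] by simp
  moreover have "0 \<le> a ^ 4" "0 \<le> b\<^sup>2" "0 \<le> c ^ 4" by auto
  ultimately show ?thesis by linarith
qed

lemma abs_sum3_le:
  assumes "\<And>i. \<bar>f i\<bar> \<le> (B::real)" shows "\<bar>\<Sum>i\<in>(UNIV::3 set). f i\<bar> \<le> 3 * B"
  using assms[of 1] assms[of 2] assms[of 3] unfolding sum_3 by linarith

lemma abs_mult_le: "\<bar>a\<bar> \<le> A \<Longrightarrow> \<bar>b\<bar> \<le> B \<Longrightarrow> \<bar>a * b\<bar> \<le> A * (B::real)"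
  unfolding abs_mult by (intro mult_mono) auto

text \<open>In the application \<open>V\<close> and \<open>g\<close> bound the field and its
  gradient, \<open>A\<close> and \<open>B\<close> their ray means with weights \<open>t\<close> and
  \<open>t\<^sup>2\<close>. The potential grows like \<open>R * A\<close>, and the factor
  \<open>1 / R\<close> from each derivative of the cutoff compensates, so Young's inequality leaves
  only integrable powers and \<open>(1 / R) ^ 4\<close>.\<close>

lemma error_bound_algebra:
  fixes v P G :: "3 \<Rightarrow> real" and w D Q dD :: "3 \<Rightarrow> 3 \<Rightarrow> real" and dDD :: "3 \<Rightarrow> 3 \<Rightarrow> 3 \<Rightarrow> real"
  assumes R: "R > 0" and P: "\<And>j. \<bar>P j\<bar> \<le> c / R" and Q: "\<And>j k. \<bar>Q k j\<bar> \<le> c / R\<^sup>2"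
    and v: "\<And>i. \<bar>v i\<bar> \<le> V" and w: "\<And>i j. \<bar>w i j\<bar> \<le> g"
    and D: "\<And>i j. \<bar>D i j\<bar> \<le> 4 * R * A" and dDD: "\<And>k i j. \<bar>dDD k i j\<bar> \<le> 2 * A + 4 * R * B"
    and G: "\<And>i. G i = (\<Sum>k\<in>UNIV. P k * D i k)"
    and dG: "\<And>i j. dG i j = (\<Sum>k\<in>UNIV. Q j k * D i k + P k * dDD j i k)"
  shows "\<bar>(\<Sum>i\<in>UNIV. \<Sum>j\<in>UNIV. P j * v i * w i j) + (\<Sum>i\<in>UNIV. \<Sum>j\<in>UNIV. dG i j * w i j)
      + (\<Sum>i\<in>UNIV. \<Sum>j\<in>UNIV. G i * v j * w i j)
      - (\<Sum>j\<in>UNIV. P j * v j) * (\<Sum>i\<in>UNIV. v i * v i) / 2\<bar>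
    \<le> 400 * c * (V ^ 4 + g\<^sup>2 + A ^ 4 + B\<^sup>2 + (1 / R) ^ 4)"
proof -
  \<comment> \<open>Naming \<open>1 / R\<close> makes it one more factor for Young's inequality; the
    powers of \<open>R\<close> then disappear through \<open>R * e = 1\<close>.\<close>
  define e where "e = 1 / R"
  have Re: "R * e = 1" using R by (simp add: e_def)
  have Pe: "\<bar>P j\<bar> \<le> c * e" for j using P[of j] by (simp add: e_def)
  have Qe: "\<bar>Q k j\<bar> \<le> c * e\<^sup>2" for k j using Q[of k j] by (simp add: e_def power_divide)
  have ce: "0 \<le> c * e" using Pe[of 1] by linarith
  then have c: "0 \<le> c" using R by (simp add: e_def zero_le_divide_iff)
  have "\<bar>G i\<bar> \<le> 3 * ((c * e) * (4 * R * A))" for i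
    unfolding G by (intro abs_sum3_le abs_mult_le Pe D)
  moreover have "3 * ((c * e) * (4 * R * A)) = 12 * c * A"
    using Re by algebra
  ultimately have Gb: "\<bar>G i\<bar> \<le> 12 * c * A" for i by simp
  have "\<bar>dG i j\<bar> \<le> 3 * ((c * e\<^sup>2) * (4 * R * A) + (c * e) * (2 * A + 4 * R * B))" for i j
    unfolding dG
    by (intro abs_sum3_le order_trans[OF abs_triangle_ineq] add_mono abs_mult_le Qe Pe D dDD)
  moreover have "3 * ((c * e\<^sup>2) * (4 * R * A) + (c * e) * (2 * A + 4 * R * B)) = 18 * c * A * e + 12 * c * B"
    using Re by algebra
  ultimately have dGb: "\<bar>dG i j\<bar> \<le> 18 * c * A * e + 12 * c * B" for i j by simp
  have "\<bar>\<Sum>i\<in>UNIV. \<Sum>j\<in>UNIV. P j * v i * w i j\<bar> \<le> 3 * (3 * (c * e * V * g))"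
    by (intro abs_sum3_le abs_mult_le Pe v w)
  moreover have "\<bar>\<Sum>i\<in>UNIV. \<Sum>j\<in>UNIV. dG i j * w i j\<bar> \<le> 3 * (3 * ((18 * c * A * e + 12 * c * B) * g))"
    by (intro abs_sum3_le abs_mult_le dGb w)
  moreover have "\<bar>\<Sum>i\<in>UNIV. \<Sum>j\<in>UNIV. G i * v j * w i j\<bar> \<le> 3 * (3 * (12 * c * A * V * g))"
    by (intro abs_sum3_le abs_mult_le Gb v w)
  moreover have "\<bar>(\<Sum>j\<in>UNIV. P j * v j) * (\<Sum>i\<in>UNIV. v i * v i)\<bar> \<le> (3 * (c * e * V)) * (3 * (V * V))"
    by (intro abs_sum3_le abs_mult_le Pe v)
  ultimately have "\<bar>(\<Sum>i\<in>UNIV. \<Sum>j\<in>UNIV. P j * v i * w i j) + (\<Sum>i\<in>UNIV. \<Sum>j\<in>UNIV. dG i j * w i j)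
      + (\<Sum>i\<in>UNIV. \<Sum>j\<in>UNIV. G i * v j * w i j)
      - (\<Sum>j\<in>UNIV. P j * v j) * (\<Sum>i\<in>UNIV. v i * v i) / 2\<bar>
    \<le> 3 * (3 * (c * e * V * g)) + 3 * (3 * ((18 * c * A * e + 12 * c * B) * g))
      + 3 * (3 * (12 * c * A * V * g)) + (3 * (c * e * V)) * (3 * (V * V)) / 2"
    by linarith
  also have "\<dots> = c * (9 * (V * g * e) + 162 * (A * g * e) + 108 * (B * g * 1) + 108 * (A * g * V) + 9 / 2 * (V * V\<^sup>2 * e))"
    by (simp add: power2_eq_square algebra_simps)
  also have "\<dots> \<le> c * (400 * (V ^ 4 + g\<^sup>2 + A ^ 4 + B\<^sup>2 + e ^ 4))"
  proof (rule mult_left_mono[OF _ c])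
    \<comment> \<open>Products and powers are abstracted to variables. The largest coefficient
      collected is \<open>9 + 162 + 108 + 108 = 387\<close>, at \<open>g\<^sup>2\<close>; it is
      rounded up to 400.\<close>
    have linear: "9 * x1 + 162 * x2 + 108 * x3 + 108 * x4 + 9 / 2 * x5 \<le> 400 * (y1 + y2 + y3 + y4 + y5)"
      if "x1 \<le> y1 + y2 + y5" "x2 \<le> y3 + y2 + y5" "x3 \<le> y4 + y2" "x4 \<le> y3 + y2 + y1" "x5 \<le> 2 * y1 + y5"
        "0 \<le> y1" "0 \<le> y2" "0 \<le> y3" "0 \<le> y4" "0 \<le> y5" for x1 x2 x3 x4 x5 y1 y2 y3 y4 y5 :: real
      using that by argo
    have Bg: "B * g * 1 \<le> B\<^sup>2 + g\<^sup>2"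
    proof -
      have "2 * (B * g) \<le> B\<^sup>2 + g\<^sup>2" using sum_squares_bound[of B g] by (simp add: mult_ac)
      moreover have "0 \<le> B\<^sup>2 + g\<^sup>2" by simp
      ultimately show ?thesis by linarith
    qed
    have V3: "V * V\<^sup>2 * e \<le> 2 * V ^ 4 + e ^ 4"
      using mult3_le[of V "V\<^sup>2" e] by simp
    show "9 * (V * g * e) + 162 * (A * g * e) + 108 * (B * g * 1) + 108 * (A * g * V) + 9 / 2 * (V * V\<^sup>2 * e)
        \<le> 400 * (V ^ 4 + g\<^sup>2 + A ^ 4 + B\<^sup>2 + e ^ 4)"
      by (rule linear[OF mult3_le mult3_le Bg mult3_le V3]) auto
  qed
  finally show ?thesis by (simp add: e_def mult.assoc mult.left_commute)
qed

lemma has_partial_cdivide: "has_partial j f F \<Longrightarrow> has_partial j (\<lambda>x. f x / c) (\<lambda>x. F x / c)"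
  by (rule has_partialI) (rule DERIV_cdivide, rule has_partialD)

section \<open>Energy density and error density\<close>

definition energy_density :: "(3 \<Rightarrow> real^3 \<Rightarrow> real) \<Rightarrow> real^3 \<Rightarrow> real" where
  "energy_density v x = (\<Sum>i\<in>UNIV. \<Sum>j\<in>UNIV. (partial j (v i) x)\<^sup>2)"

text \<open>Up to a multiple and the term \<open>(1 / R) ^ 4\<close> this dominates the error terms
  for every cutoff radius. It does not depend on \<open>R\<close>, so its tail integrals tend to
  zero once it is integrable.\<close>

definition error_density :: "(3 \<Rightarrow> real^3 \<Rightarrow> real) \<Rightarrow> real^3 \<Rightarrow> real" where
  "error_density v x = (\<Sum>i\<in>UNIV. v i x ^ 4) + energy_density v x
     + (\<Sum>i\<in>UNIV. ray_mean 4 (\<lambda>y. v i y ^ 4) x)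
     + (\<Sum>i\<in>UNIV. \<Sum>j\<in>UNIV. ray_mean 4 (\<lambda>y. (partial j (v i) y)\<^sup>2) x)"

lemma ray_mean_nonneg:
  fixes w :: "real^3 \<Rightarrow> real"
  assumes "continuous_on UNIV w" "\<And>x. 0 \<le> w x"
  shows "0 \<le> ray_mean k w x"
  unfolding ray_mean_def
  by (rule integral_nonneg) (auto intro!: integrable_continuous_interval continuous_on_ray assms mult_nonneg_nonneg)

context
  fixes v :: "3 \<Rightarrow> real^3 \<Rightarrow> real"
  assumes v: "\<And>i. smooth_fun (v i)"
begin

lemma continuous_components:
  "continuous_on UNIV (v i)" "continuous_on UNIV (partial j (v i))"
  "continuous_on UNIV (partial k (partial j (v i)))"
  using v by (auto intro: smooth_fun_continuous smooth_fun_partial)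

lemma energy_density_nonneg: "0 \<le> energy_density v x"
  unfolding energy_density_def by (intro sum_nonneg) auto

lemma continuous_energy_density: "continuous_on UNIV (energy_density v)"
  unfolding energy_density_def[abs_def] by (intro continuous_intros continuous_components)

lemma error_density_summands_nonneg:
  "0 \<le> (\<Sum>i\<in>UNIV. v i x ^ 4)"
  "0 \<le> (\<Sum>i\<in>UNIV. ray_mean 4 (\<lambda>y. v i y ^ 4) x)"
  "0 \<le> (\<Sum>i\<in>UNIV. \<Sum>j\<in>UNIV. ray_mean 4 (\<lambda>y. (partial j (v i) y)\<^sup>2) x)"
  by (intro sum_nonneg ray_mean_nonneg continuous_intros continuous_components; simp)+

lemma error_density_nonneg: "0 \<le> error_density v x"
  unfolding error_density_def
  using error_density_summands_nonneg[of x] energy_density_nonneg[of x] by linarith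

text \<open>The ray means inherit finite integrals through \<open>nn_integral_ray_mean_le\<close>,
  since both families carry the weight \<open>t ^ 4\<close>.\<close>

lemma integrable_error_density:
  assumes v4: "\<And>i. (\<integral>\<^sup>+x. ennreal (v i x ^ 4) \<partial>lborel) < \<infinity>"
    and w2: "\<And>i j. (\<integral>\<^sup>+x. ennreal ((partial j (v i) x)\<^sup>2) \<partial>lborel) < \<infinity>"
  shows "integrable lborel (error_density v)" "integrable lborel (energy_density v)"
proof -
  have cont: "integrable lborel h"
    if "continuous_on UNIV h" "\<And>x. 0 \<le> h x" "(\<integral>\<^sup>+x. ennreal (h x) \<partial>lborel) < \<infinity>" for h :: "real^3 \<Rightarrow> real"
  proof (rule integrableI_bounded)
    show "h \<in> borel_measurable lborel" using that(1) by (simp add: borel_measurable_continuous_onI)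
    show "(\<integral>\<^sup>+x. ennreal (norm (h x)) \<partial>lborel) < \<infinity>" using that(2,3) by simp
  qed
  have ray: "integrable lborel (ray_mean 4 h)"
    if h: "continuous_on UNIV h" "\<And>x. 0 \<le> h x" "(\<integral>\<^sup>+x. ennreal (h x) \<partial>lborel) < \<infinity>" for h :: "real^3 \<Rightarrow> real"
    using nn_integral_ray_mean_le[OF h(1,2)] h(3)
    by (intro cont continuous_ray_mean ray_mean_nonneg h) (auto intro: le_less_trans)
  have c: "continuous_on UNIV (\<lambda>x. v i x ^ 4)" "continuous_on UNIV (\<lambda>x. (partial j (v i) x)\<^sup>2)" for i j
    by (intro continuous_intros continuous_components)+
  show e: "integrable lborel (energy_density v)"
    unfolding energy_density_def[abs_def]
    by (intro Bochner_Integration.integrable_sum cont c w2) auto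
  show "integrable lborel (error_density v)"
    unfolding error_density_def[abs_def]
    by (intro Bochner_Integration.integrable_sum Bochner_Integration.integrable_add ray cont e c v4 w2) auto
qed

text \<open>The field \<open>\<Sum>j. \<partial>\<^sub>j (\<phi> D\<^sub>i\<^sub>j)\<close> is divergence free because \<open>D\<close> is skew, so testing the equation with it
  removes the pressure.  It equals \<open>\<phi> v\<^sub>i + G\<^sub>i\<close>, where \<open>G\<close> lives on the shell where \<open>\<phi>\<close> is not constant.\<close>

lemma stationary_energy_bound:
  fixes p :: "real^3 \<Rightarrow> real"
  assumes p: "smooth_fun p"
    and NS: "\<And>i x. (\<Sum>j\<in>UNIV. v j x * partial j (v i) x) - (\<Sum>j\<in>UNIV. partial j (partial j (v i)) x) = partial i p x"
    and div: "\<And>x. (\<Sum>j\<in>UNIV. partial j (v j) x) = 0"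
    and int: "integrable lborel (error_density v)"
  obtains C where "\<And>R. R \<ge> 1 \<Longrightarrow>
    (\<integral>x. indicator (cball 0 R) x * energy_density v x \<partial>lborel)
      \<le> C * ((\<integral>x. indicator {x. R \<le> norm x} x * error_density v x \<partial>lborel) + 1 / R)"
proof -
  obtain c :: real where c: "c > 0" and cutoff: "\<And>R. R \<ge> 1 \<Longrightarrow> \<exists>\<phi> P Q. radial_cutoff c R \<phi> P Q"
    using radial_cutoff_exists by blast
  define vol where "vol = measure lborel (ball (0::real^3) 1)"
  have vol0: "0 \<le> vol" by (simp add: vol_def)
  define w where "w = (\<lambda>i j. partial j (v i))"
  define D where "D = skew_potential v"
  define dD where "dD = skew_potential_partial v"
  have hw: "has_partial j (v i) (w i j)" for i j
    unfolding w_def by (rule smooth_fun_has_partial[OF v])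
  have hL: "has_partial j (w i j) (partial j (partial j (v i)))" for i j
    unfolding w_def by (intro smooth_fun_has_partial smooth_fun_partial v)
  have hp: "has_partial j (partial i p) (partial j (partial i p))" for i j
    by (intro smooth_fun_has_partial smooth_fun_partial p)
  have hD: "has_partial k (D i j) (dD k i j)" for i j k
    unfolding D_def dD_def by (rule has_partial_skew_potential[OF v])
  have cp: "continuous_on UNIV (partial i p)" "continuous_on UNIV (partial j (partial i p))" for i j
    by (intro smooth_fun_continuous smooth_fun_partial p)+
  have cw: "continuous_on UNIV (w i j)" for i j
    unfolding w_def by (rule continuous_components)
  have cD: "continuous_on UNIV (D i j)" "continuous_on UNIV (dD k i j)" for i j k
    unfolding D_def dD_def by (rule continuous_skew_potential[OF v])+
  \<comment> \<open>\<open>10800 = 400 * 27\<close> combines the constant of the error bound with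
    that of the fourth power inequality. The factor \<open>1 + vol\<close> dominates both the
    coefficient 1 of the tail integral and the coefficient \<open>vol\<close> of
    \<open>1 / R\<close>.\<close>
  have bound: "(\<integral>x. indicator (cball 0 R) x * energy_density v x \<partial>lborel)
      \<le> (10800 * c * (1 + vol)) * ((\<integral>x. indicator {x. R \<le> norm x} x * error_density v x \<partial>lborel) + 1 / R)"
    if R: "R \<ge> 1" for R
  proof -
    have R0: "R > 0" using R by simp
    obtain \<phi> P Q where "radial_cutoff c R \<phi> P Q" using cutoff[OF R] by blast
    then have hP: "\<And>j. has_partial j \<phi> (P j)" and hQ: "\<And>j k. has_partial k (P j) (Q k j)"
      and c\<phi>: "continuous_on UNIV \<phi>" and cP: "\<And>j. continuous_on UNIV (P j)" and cQ: "\<And>j k. continuous_on UNIV (Q k j)"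
      and \<phi>0: "\<And>x. 0 \<le> \<phi> x" and \<phi>1: "\<And>x. norm x \<le> R \<Longrightarrow> \<phi> x = 1" and \<phi>2: "\<And>x. norm x > 2 * R \<Longrightarrow> \<phi> x = 0"
      and P0: "\<And>x j. norm x < R \<or> norm x > 2 * R \<Longrightarrow> P j x = 0"
      and Q0: "\<And>x j k. norm x < R \<or> norm x > 2 * R \<Longrightarrow> Q k j x = 0"
      and Pb: "\<And>x j. \<bar>P j x\<bar> \<le> c / R" and Qb: "\<And>x j k. \<bar>Q k j x\<bar> \<le> c / R\<^sup>2"
      unfolding radial_cutoff_def by blast+
    define G where "G = (\<lambda>i x. \<Sum>k\<in>UNIV. P k x * D i k x)"
    define dG where "dG = (\<lambda>i j x. \<Sum>k\<in>UNIV. Q j k x * D i k x + P k x * dD j i k x)"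
    \<comment> \<open>The flux consists of the test field paired with derivatives of
      \<open>v\<close>, the pressure gradient paired with \<open>\<phi>\<close> times
      \<open>D\<close>, and the flux of kinetic energy. Differentiating the pressure gradient yields
      a Hessian, which the skewness of \<open>D\<close> annihilates.\<close>
    define X where "X = (\<lambda>j x. (\<Sum>i\<in>UNIV. (\<phi> x * v i x + G i x) * w i j x)
        + (\<Sum>i\<in>UNIV. partial i p x * (\<phi> x * D i j x)) - (\<phi> x * v j x) * (\<Sum>i\<in>UNIV. v i x * v i x) / 2)"
    define dX where "dX = (\<lambda>j x.
        (\<Sum>i\<in>UNIV. ((P j x * v i x + \<phi> x * w i j x) + dG i j x) * w i j x
            + (\<phi> x * v i x + G i x) * partial j (partial j (v i)) x)
        + (\<Sum>i\<in>UNIV. partial j (partial i p) x * (\<phi> x * D i j x) + partial i p x * (P j x * D i j x + \<phi> x * dD j i j x))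
        - ((P j x * v j x + \<phi> x * w j j x) * (\<Sum>i\<in>UNIV. v i x * v i x)
            + \<phi> x * v j x * (\<Sum>i\<in>UNIV. w i j x * v i x + v i x * w i j x)) / 2)"
    define E where "E = (\<lambda>x. (\<Sum>i\<in>UNIV. \<Sum>j\<in>UNIV. P j x * v i x * w i j x) + (\<Sum>i\<in>UNIV. \<Sum>j\<in>UNIV. dG i j x * w i j x)
        + (\<Sum>i\<in>UNIV. \<Sum>j\<in>UNIV. G i x * v j x * w i j x)
        - (\<Sum>j\<in>UNIV. P j x * v j x) * (\<Sum>i\<in>UNIV. v i x * v i x) / 2)"
    have hG: "has_partial j (G i) (dG i j)" for i j
      unfolding G_def dG_def by (intro has_partial_sum has_partial_mult hQ hD)
    have cG: "continuous_on UNIV (G i)" "continuous_on UNIV (dG i j)" for i j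
      unfolding G_def dG_def by (intro continuous_intros cP cQ cD)+
    have hX: "has_partial j (X j) (dX j)" for j
      unfolding X_def dX_def
      by (intro has_partial_diff has_partial_add has_partial_cdivide has_partial_sum has_partial_mult hP hw hG hL hp hD)
    have cX: "continuous_on UNIV (X j)" "continuous_on UNIV (dX j)" for j
      unfolding X_def dX_def
      by (intro continuous_intros c\<phi> cP cG cD cp cw continuous_components; simp)+
    have X0: "X j x = 0" if "norm x > 2 * R" for j x
      using \<phi>2[OF that] P0[of x] that by (simp add: X_def G_def)
    have dX_int: "integrable lborel (dX j)" "(\<integral>x. dX j x \<partial>lborel) = 0" for j
      using integral_partial_eq_0[OF hX cX X0] by blast+
    have energy: "energy_density v x = (\<Sum>i\<in>UNIV. \<Sum>j\<in>UNIV. (w i j x)\<^sup>2)" for x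
      by (simp add: energy_density_def w_def)
    have identity: "(\<Sum>j\<in>UNIV. dX j x) = \<phi> x * energy_density v x + E x" for x
      unfolding dX_def E_def energy
    proof (rule energy_identity_algebra)
      show "(\<Sum>j\<in>UNIV. v j x * w i j x) - (\<Sum>j\<in>UNIV. partial j (partial j (v i)) x) = partial i p x" for i
        using NS by (simp add: w_def)
      show "(\<Sum>j\<in>UNIV. w j j x) = 0" using div by (simp add: w_def)
      show "D i j x = - D j i x" for i j unfolding D_def by (rule skew_potential_skew)
      show "partial j (partial i p) x = partial i (partial j p) x" for i j
        by (rule partials_commute_smooth[OF p])
      show "(\<Sum>j\<in>UNIV. dD j i j x) = v i x" for i
        unfolding dD_def by (rule div_skew_potential[OF v div])
    qed (simp add: G_def)
    have e_int: "integrable lborel (\<lambda>x. \<phi> x * energy_density v x)"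
      by (rule integrable_continuous_compact_support[of _ "2 * R"])
        (auto intro!: continuous_intros c\<phi> continuous_energy_density simp: \<phi>2)
    \<comment> \<open>Integrability of \<open>E\<close> is read off from the identity, since the
      other two terms are integrable.\<close>
    have "integrable lborel (\<lambda>x. (\<Sum>j\<in>UNIV. dX j x) - \<phi> x * energy_density v x)"
      by (intro Bochner_Integration.integrable_diff Bochner_Integration.integrable_sum dX_int e_int)
    then have E_int: "integrable lborel E" unfolding identity by simp
    have "(\<integral>x. \<phi> x * energy_density v x \<partial>lborel) + (\<integral>x. E x \<partial>lborel) = (\<integral>x. (\<Sum>j\<in>UNIV. dX j x) \<partial>lborel)"
      unfolding identity using e_int E_int by simp
    also have "\<dots> = 0" using dX_int by (subst Bochner_Integration.integral_sum) auto
    finally have balance: "(\<integral>x. \<phi> x * energy_density v x \<partial>lborel) = - (\<integral>x. E x \<partial>lborel)" by simp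
    let ?S = "\<lambda>x. indicator {x. R \<le> norm x} x * error_density v x"
    \<comment> \<open>The constant \<open>(1 / R) ^ 4\<close> is incurred only on the closed shell,
      which lies in the open ball of radius \<open>3 * R\<close>; over that ball it integrates to a
      multiple of \<open>1 / R\<close>.\<close>
    let ?T = "\<lambda>x :: real^3. (1 / R) ^ 4 * indicator (ball 0 (3 * R)) x :: real"
    have E_bound: "\<bar>E x\<bar> \<le> 400 * c * (27 * ?S x + ?T x)" for x
    proof (cases "norm x < R \<or> norm x > 2 * R")
      case True
      then have "P j x = 0" "Q k j x = 0" for j k using P0 Q0 by auto
      then have "E x = 0" by (simp add: E_def G_def dG_def)
      moreover have "0 \<le> 400 * c * (27 * ?S x + ?T x)"
        using c error_density_nonneg[of x] by (intro mult_nonneg_nonneg add_nonneg_nonneg) auto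
      ultimately show ?thesis by simp
    next
      case False
      define V where "V = (\<Sum>i\<in>UNIV. \<bar>v i x\<bar>)"
      define g where "g = (\<Sum>i\<in>UNIV. \<Sum>j\<in>UNIV. \<bar>w i j x\<bar>)"
      define A where "A = (\<Sum>i\<in>UNIV. \<bar>ray_mean 1 (v i) x\<bar>)"
      define B where "B = (\<Sum>i\<in>UNIV. \<Sum>j\<in>UNIV. \<bar>ray_mean 2 (partial j (v i)) x\<bar>)"
      have single: "\<bar>f i\<bar> \<le> (\<Sum>i\<in>UNIV. \<bar>f i\<bar>)" for f :: "3 \<Rightarrow> real" and i
        by (rule member_le_sum) auto
      have double: "\<bar>f i j\<bar> \<le> (\<Sum>i\<in>UNIV. \<Sum>j\<in>UNIV. \<bar>f i j\<bar>)" for f :: "3 \<Rightarrow> 3 \<Rightarrow> real" and i j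
      proof -
        have "\<bar>f i j\<bar> \<le> (\<Sum>j\<in>UNIV. \<bar>f i j\<bar>)" by (rule single)
        also have "\<dots> \<le> (\<Sum>i\<in>UNIV. \<Sum>j\<in>UNIV. \<bar>f i j\<bar>)"
          by (rule member_le_sum[of i UNIV "\<lambda>i. \<Sum>j\<in>UNIV. \<bar>f i j\<bar>"]) (auto intro: sum_nonneg)
        finally show ?thesis .
      qed
      have xj: "\<bar>x $ j\<bar> \<le> 2 * R" for j using component_le_norm_cart[of x j] False by linarith
      have A1: "\<bar>ray_mean 1 (v i) x\<bar> \<le> A" for i unfolding A_def by (rule single)
      have B1: "\<bar>ray_mean 2 (partial j (v i)) x\<bar> \<le> B" for i j unfolding B_def by (rule double)
      have A0: "0 \<le> A" unfolding A_def by (intro sum_nonneg) auto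
      have Db: "\<bar>D i j x\<bar> \<le> 4 * R * A" for i j
        using abs_mult_le[OF xj[of j] A1[of i]] abs_mult_le[OF xj[of i] A1[of j]]
        unfolding D_def skew_potential_def by linarith
      have dDb: "\<bar>dD k i j x\<bar> \<le> 2 * A + 4 * R * B" for i j k
      proof -
        have d: "\<bar>(if j = k then 1 else 0) * ray_mean 1 (v i) x\<bar> \<le> A" for i j
          using A1[of i] A0 by simp
        have "\<bar>(if j = k then 1 else 0) * ray_mean 1 (v i) x + x $ j * ray_mean 2 (partial k (v i)) x\<bar> \<le> A + 2 * R * B" for i j
          using d abs_mult_le[OF xj[of j] B1[of k i]] by (intro order_trans[OF abs_triangle_ineq] add_mono)
        from order_trans[OF abs_triangle_ineq4 add_mono[OF this[of j i] this[of i j]]]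
        show ?thesis unfolding dD_def skew_potential_partial_def by (rule order_trans) simp
      qed
      have "\<bar>E x\<bar> \<le> 400 * c * (V ^ 4 + g\<^sup>2 + A ^ 4 + B\<^sup>2 + (1 / R) ^ 4)"
        unfolding E_def
      proof (rule error_bound_algebra[OF R0 Pb Qb _ _ Db dDb])
        show "\<bar>v i x\<bar> \<le> V" for i unfolding V_def by (rule single)
        show "\<bar>w i j x\<bar> \<le> g" for i j unfolding g_def by (rule double)
        show "G i x = (\<Sum>k\<in>UNIV. P k x * D i k x)" for i by (simp add: G_def)
        show "dG i j x = (\<Sum>k\<in>UNIV. Q j k x * D i k x + P k x * dD j i k x)" for i j by (simp add: dG_def)
      qed
      also have "\<dots> \<le> 400 * c * (27 * error_density v x + (1 / R) ^ 4)"
      proof (intro mult_left_mono add_right_mono)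
        have "V ^ 4 \<le> 27 * (\<Sum>i\<in>UNIV. v i x ^ 4)"
          using sum3_power4_le[of "\<lambda>i. \<bar>v i x\<bar>"] by (simp add: V_def power_even_abs)
        moreover have "g\<^sup>2 \<le> 9 * energy_density v x"
          using sum33_square_le[of "\<lambda>i j. \<bar>w i j x\<bar>"] by (simp add: g_def energy_density_def w_def)
        moreover have "A ^ 4 \<le> 27 * (\<Sum>i\<in>UNIV. ray_mean 4 (\<lambda>y. v i y ^ 4) x)"
        proof -
          have "A ^ 4 \<le> 27 * (\<Sum>i\<in>UNIV. ray_mean 1 (v i) x ^ 4)"
            using sum3_power4_le[of "\<lambda>i. \<bar>ray_mean 1 (v i) x\<bar>"] by (simp add: A_def power_even_abs)
          also have "\<dots> \<le> 27 * (\<Sum>i\<in>UNIV. ray_mean 4 (\<lambda>y. v i y ^ 4) x)"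
            by (intro mult_left_mono sum_mono ray_mean_power4 continuous_components) auto
          finally show ?thesis .
        qed
        moreover have "B\<^sup>2 \<le> 9 * (\<Sum>i\<in>UNIV. \<Sum>j\<in>UNIV. ray_mean 4 (\<lambda>y. (partial j (v i) y)\<^sup>2) x)"
        proof -
          have "B\<^sup>2 \<le> 9 * (\<Sum>i\<in>UNIV. \<Sum>j\<in>UNIV. (ray_mean 2 (partial j (v i)) x)\<^sup>2)"
            using sum33_square_le[of "\<lambda>i j. \<bar>ray_mean 2 (partial j (v i)) x\<bar>"] by (simp add: B_def)
          also have "\<dots> \<le> 9 * (\<Sum>i\<in>UNIV. \<Sum>j\<in>UNIV. ray_mean 4 (\<lambda>y. (partial j (v i) y)\<^sup>2) x)"
            using ray_mean_power2[OF continuous_components(2), of 2]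
            by (intro mult_left_mono sum_mono) auto
          finally show ?thesis .
        qed
        ultimately show "V ^ 4 + g\<^sup>2 + A ^ 4 + B\<^sup>2 \<le> 27 * error_density v x"
          using error_density_summands_nonneg[of x] energy_density_nonneg[of x]
          unfolding error_density_def by argo
      qed (use c in auto)
      also have "\<dots> = 400 * c * (27 * ?S x + ?T x)"
        using False R0 by (auto simp: indicator_def)
      finally show ?thesis .
    qed
    have meas: "{x :: real^3. R \<le> norm x} \<in> sets lborel" by measurable
    have S_int: "integrable lborel ?S"
      using integrable_real_mult_indicator[OF meas int] by (simp add: mult.commute)
    have T_int: "integrable lborel ?T"
      using emeasure_lborel_ball_finite[of "0::real^3" "3 * R"]
      by (intro integrable_mult_right integrable_real_indicator) auto
    have T_val: "(\<integral>x. ?T x \<partial>lborel) = 27 * vol / R"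
      using content_ball_conv_unit_ball[of "3 * R" "0::real^3"] R0
      by (simp add: vol_def power_mult_distrib field_simps eval_nat_numeral)
    have "(\<integral>x. indicator (cball 0 R) x * energy_density v x \<partial>lborel) \<le> (\<integral>x. \<phi> x * energy_density v x \<partial>lborel)"
    proof (rule integral_mono_AE'[OF e_int])
      show "AE x in lborel. indicator (cball 0 R) x * energy_density v x \<le> \<phi> x * energy_density v x"
        using \<phi>0 \<phi>1 energy_density_nonneg by (intro AE_I2) (auto simp: indicator_def)
      show "AE x in lborel. 0 \<le> \<phi> x * energy_density v x"
        using \<phi>0 energy_density_nonneg by auto
    qed
    also have "\<dots> \<le> (\<integral>x. \<bar>E x\<bar> \<partial>lborel)"
      unfolding balance using integral_abs_bound[of lborel E] by linarith
    also have "\<dots> \<le> (\<integral>x. 400 * c * (27 * ?S x + ?T x) \<partial>lborel)"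
      using E_int S_int T_int E_bound by (intro integral_mono) auto
    also have "\<dots> = 400 * c * (27 * (\<integral>x. ?S x \<partial>lborel) + 27 * vol / R)"
      using S_int T_int T_val by simp
    also have "\<dots> = 10800 * c * ((\<integral>x. ?S x \<partial>lborel) + vol * (1 / R))" by (simp add: algebra_simps)
    also have "\<dots> \<le> 10800 * c * ((1 + vol) * (\<integral>x. ?S x \<partial>lborel) + (1 + vol) * (1 / R))"
    proof -
      have "0 \<le> (\<integral>x. ?S x \<partial>lborel)"
        using error_density_nonneg by (intro integral_nonneg_AE) auto
      then have "1 * (\<integral>x. ?S x \<partial>lborel) \<le> (1 + vol) * (\<integral>x. ?S x \<partial>lborel)"
        using vol0 by (intro mult_right_mono) auto
      moreover have "vol * (1 / R) \<le> (1 + vol) * (1 / R)"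
        using R0 by (intro mult_right_mono) auto
      ultimately show ?thesis using c by (intro mult_left_mono) auto
    qed
    finally show ?thesis unfolding distrib_left[symmetric] mult.assoc .
  qed
  show ?thesis by (rule that[OF bound])
qed

text \<open>The energy in the ball of radius \<open>n\<close> tends to the full energy, while its
  bound tends to zero, being a multiple of the tail of an integrable function plus
  \<open>1 / n\<close>. The continuous energy density therefore vanishes identically.\<close>

lemma stationary_gradient_eq_0:
  assumes p: "smooth_fun p"
    and NS: "\<And>i x. (\<Sum>j\<in>UNIV. v j x * partial j (v i) x) - (\<Sum>j\<in>UNIV. partial j (partial j (v i)) x) = partial i p x"
    and div: "\<And>x. (\<Sum>j\<in>UNIV. partial j (v j) x) = 0"
    and v4: "\<And>i. (\<integral>\<^sup>+x. ennreal (v i x ^ 4) \<partial>lborel) < \<infinity>"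
    and w2: "\<And>i j. (\<integral>\<^sup>+x. ennreal ((partial j (v i) x)\<^sup>2) \<partial>lborel) < \<infinity>"
  shows "partial j (v i) x = 0"
proof -
  note ints = integrable_error_density[OF v4 w2]
  obtain C where C: "\<And>R. R \<ge> 1 \<Longrightarrow> (\<integral>x. indicator (cball 0 R) x * energy_density v x \<partial>lborel)
      \<le> C * ((\<integral>x. indicator {x. R \<le> norm x} x * error_density v x \<partial>lborel) + 1 / R)"
    using stationary_energy_bound[OF p NS div ints(1)] by blast
  have [measurable]: "error_density v \<in> borel_measurable lborel" "energy_density v \<in> borel_measurable lborel"
    using ints by auto
  have "(\<lambda>n. \<integral>x. indicator (cball 0 (real n)) x * energy_density v x \<partial>lborel) \<longlonglongrightarrow> (\<integral>x. energy_density v x \<partial>lborel)"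
  proof (rule integral_dominated_convergence[OF _ _ ints(2)])
    show "AE x in lborel. (\<lambda>n. indicator (cball 0 (real n)) x * energy_density v x) \<longlonglongrightarrow> energy_density v x"
    proof (intro AE_I2 tendsto_eventually)
      fix x :: "real^3"
      obtain N :: nat where "norm x \<le> real N" using real_arch_simple by blast
      then show "\<forall>\<^sub>F n in sequentially. indicator (cball 0 (real n)) x * energy_density v x = energy_density v x"
        by (intro eventually_sequentiallyI[of N]) (auto simp: indicator_def)
    qed
    show "AE x in lborel. norm (indicator (cball 0 (real n)) x * energy_density v x) \<le> energy_density v x" for n
      using energy_density_nonneg by (intro AE_I2) (auto simp: indicator_def)
    show "(\<lambda>x. indicator (cball 0 (real n)) x * energy_density v x) \<in> borel_measurable lborel" for n
      by (intro borel_measurable_times borel_measurable_indicator) auto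
  qed measurable
  moreover have "(\<lambda>n. C * ((\<integral>x. indicator {x. real n \<le> norm x} x * error_density v x \<partial>lborel) + 1 / real n)) \<longlonglongrightarrow> C * (integral\<^sup>L lborel (\<lambda>x::real^3. 0) + 0)"
  proof (intro tendsto_intros integral_dominated_convergence[OF _ _ ints(1)] lim_1_over_n)
    show "AE x in lborel. (\<lambda>n. indicator {x. real n \<le> norm x} x * error_density v x) \<longlonglongrightarrow> 0"
    proof (intro AE_I2 tendsto_eventually)
      fix x :: "real^3"
      obtain N :: nat where "norm x < real N" using reals_Archimedean2 by blast
      then show "\<forall>\<^sub>F n in sequentially. indicator {x. real n \<le> norm x} x * error_density v x = 0"
        by (intro eventually_sequentiallyI[of N]) (auto simp: indicator_def)
    qed
    show "AE x in lborel. norm (indicator {x. real n \<le> norm x} x * error_density v x) \<le> error_density v x" for n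
      using error_density_nonneg by (intro AE_I2) (auto simp: indicator_def)
  qed measurable
  \<comment> \<open>The comparison of the two sequences holds from \<open>n = 1\<close> on, where
    the energy bound applies.\<close>
  ultimately have "(\<integral>x. energy_density v x \<partial>lborel) \<le> C * (integral\<^sup>L lborel (\<lambda>x::real^3. 0) + 0)"
    by (rule LIMSEQ_le) (use C in \<open>auto intro!: exI[of _ 1]\<close>)
  then have "(\<integral>x. energy_density v x \<partial>lborel) = 0"
    using energy_density_nonneg by (simp add: order_antisym integral_nonneg_AE)
  then have "AE x in lborel. energy_density v x = 0"
    using integral_nonneg_eq_0_iff_AE[OF ints(2)] energy_density_nonneg by auto
  then have "energy_density v x = 0"
    by (rule continuous_AE_eq_0[OF continuous_energy_density])
  then have "(\<Sum>j\<in>UNIV. (partial j (v i) x)\<^sup>2) = 0"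
    unfolding energy_density_def by (subst (asm) sum_nonneg_eq_0_iff) (auto intro: sum_nonneg)
  then show ?thesis by (subst (asm) sum_nonneg_eq_0_iff) auto
qed

end

section \<open>Vanishing gradients and the Liouville conclusion\<close>

lemma smooth_fun_constant:
  assumes "smooth_fun g" "\<And>j x. partial j g x = 0"
  shows "g x = g y"
proof -
  have "((\<lambda>t. g (y + t *\<^sub>R (x - y))) has_real_derivative 0) (at t)" for t
    using smooth_fun_along_line[OF assms(1), of y "x - y" t UNIV] assms(2) by simp
  then have "g (y + 1 *\<^sub>R (x - y)) = g (y + 0 *\<^sub>R (x - y))"
    by (intro DERIV_isconst_all) auto
  then show ?thesis by simp
qed

theorem theorem1p1:
  fixes u :: "real^3 \<Rightarrow> real^3" and p :: "real^3 \<Rightarrow> real"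
  assumes smooth_u: "\<forall>i. smooth_fun (\<lambda>x. u x $ i)"
    and smooth_p: "smooth_fun p"
    and NS: "\<forall>i x. (\<Sum>j\<in>UNIV. u x $ j * partial j (\<lambda>y. u y $ i) x)
                 - (\<Sum>j\<in>UNIV. partial j (partial j (\<lambda>y. u y $ i)) x) = partial i p x"
    and div_free: "\<forall>x. (\<Sum>j\<in>UNIV. partial j (\<lambda>y. u y $ j) x) = 0"
    and bmo: "BMO_minus1 u"
    and dirichlet: "(\<integral>\<^sup>+ x. ennreal (\<Sum>i\<in>UNIV. \<Sum>j\<in>UNIV. (partial j (\<lambda>y. u y $ i) x)\<^sup>2) \<partial>lborel) < \<infinity>"
  shows "\<forall>x. u x = 0"
proof -
  let ?v = "\<lambda>i x. u x $ i"
  have v: "smooth_fun (?v i)" for i using smooth_u by blast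
  obtain \<eta> :: "real^3 \<Rightarrow> real" where \<eta>: "\<And>z. 0 \<le> \<eta> z" "\<And>z. norm z > 2 \<Longrightarrow> \<eta> z = 0" "(\<integral>z. \<eta> z \<partial>lborel) = 1"
    "\<And>s v. smooth_fun (\<lambda>y. \<eta> (s *\<^sub>R y + v))"
    by (rule mollifier_exists) (rule that; assumption)
  have \<eta>c: "continuous_on UNIV \<eta>"
    using smooth_fun_continuous[OF \<eta>(4)[of 1 0]] by simp
  obtain K where K: "K > 0" "\<And>x \<rho> i. \<rho> > 0 \<Longrightarrow> \<bar>\<integral>z. u (x + \<rho> *\<^sub>R z) $ i * \<eta> z \<partial>lborel\<bar> \<le> K / \<rho>"
    using BMO_minus1_mollified_bound[OF bmo smooth_fun_continuous[OF v] \<eta>(2,4)] by blast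
  have grad_le: "(norm (grad (?v i) x))\<^sup>2 \<le> (\<Sum>i\<in>UNIV. \<Sum>j\<in>UNIV. (partial j (?v i) x)\<^sup>2)" for i x
  proof -
    have "(norm (grad (?v i) x))\<^sup>2 = (\<Sum>j\<in>UNIV. (partial j (?v i) x)\<^sup>2)"
      unfolding power2_norm_eq_inner by (simp add: inner_vec_def grad_def power2_eq_square)
    also have "\<dots> \<le> (\<Sum>i\<in>UNIV. \<Sum>j\<in>UNIV. (partial j (?v i) x)\<^sup>2)"
      by (rule member_le_sum[of i UNIV "\<lambda>i. \<Sum>j\<in>UNIV. (partial j (?v i) x)\<^sup>2"]) (auto intro: sum_nonneg)
    finally show ?thesis .
  qed
  have g2: "(\<integral>\<^sup>+x. ennreal ((norm (grad (?v i) x))\<^sup>2) \<partial>lborel) < \<infinity>" for i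
    by (rule le_less_trans[OF nn_integral_mono dirichlet]) (intro ennreal_leI grad_le)
  have w2: "(\<integral>\<^sup>+x. ennreal ((partial j (?v i) x)\<^sup>2) \<partial>lborel) < \<infinity>" for i j
  proof (rule le_less_trans[OF nn_integral_mono g2[of i]])
    fix x
    have "\<bar>grad (?v i) x $ j\<bar> \<le> norm (grad (?v i) x)" by (rule component_le_norm_cart)
    then show "ennreal ((partial j (?v i) x)\<^sup>2) \<le> ennreal ((norm (grad (?v i) x))\<^sup>2)"
      by (intro ennreal_leI) (simp add: grad_def abs_le_square_iff[symmetric])
  qed
  \<comment> \<open>Finiteness passes from the squared gradient to the fourth power through the
    mollification bound \<open>K / \<rho>\<close>.\<close>
  have v4: "(\<integral>\<^sup>+x. ennreal (?v i x ^ 4) \<partial>lborel) < \<infinity>" for i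
    using mollified_L4[OF v \<eta>(1-3) \<eta>c K, of i] g2[of i]
    by (auto intro: le_less_trans simp: ennreal_mult_less_top)
  have w0: "partial j (?v i) x = 0" for i j x
    using NS div_free by (intro stationary_gradient_eq_0[of ?v p, OF v smooth_p _ _ v4 w2]) auto
  have "u x $ i = 0" for x i
  proof (rule ccontr)
    assume nz: "u x $ i \<noteq> 0"
    \<comment> \<open>At this radius \<open>K / \<rho>\<close> is half of
      \<open>\<bar>u x $ i\<bar>\<close>, whereas the mollification of a constant is that constant,
      since \<open>\<eta>\<close> has integral one.\<close>
    define \<rho> where "\<rho> = 2 * K / \<bar>u x $ i\<bar>"
    have \<rho>: "\<rho> > 0" using K(1) nz by (simp add: \<rho>_def)
    have const: "u y $ i = u x $ i" for y
      using smooth_fun_constant[OF v w0] by blast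
    have "\<bar>u x $ i\<bar> = \<bar>\<integral>z. u (x + \<rho> *\<^sub>R z) $ i * \<eta> z \<partial>lborel\<bar>"
      unfolding const[of "x + _"] by (simp add: \<eta>(3))
    also have "\<dots> \<le> K / \<rho>" by (rule K(2)[OF \<rho>])
    also have "\<dots> = \<bar>u x $ i\<bar> / 2" using K(1) nz by (simp add: \<rho>_def)
    finally show False using nz by simp
  qed
  then show ?thesis by (simp add: vec_eq_iff)
qed

end
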